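(* The zero locus in $\mathbb{S}_{14}\subset\mathbb{P}(\Delta)$ of a general section of the vector bundle $\mathcal{U}\otimes\mathcal{L}$ on $\mathbb{S}_{14}$ is projectively isomorphic to $DG$.
   Context: We work over $\mathbb{C}$. Let $V_{14}$ be a $14$-dimensional vector space with a nondegenerate quadratic form, and $\Delta$ one of the two half-spin representations of $Spin_{14}$ ($\dim\Delta=64$). The spinor variety $\mathbb{S}_{14}\subset\mathbb{P}(\Delta)$ (lines in $\Delta$) is the closed $Spin_{14}$-orbit, i.e. the variety of lines generated by pure spinors; it has dimension $21$ and parametrizes one of the two families of $7$-dimensional isotropic subspaces of $V_{14}$. $\mathcal{L}$ is the restriction of $\mathcal{O}_{\mathbb{P}(\Delta)}(1)$ to $\mathbb{S}_{14}$, and $\mathcal{U}$ is the rank $7$ tautological bundle, whose fiber at $[y]$ is the isotropic subspace $\{v\in V_{14}: v\cdot y=0\}$ (Clifford product). One has $\det\mathcal{U}=\mathcal{L}^{-2}$, $H^0(\mathbb{S}_{14},\mathcal{L})=\Delta^\vee$ and $H^0(\mathbb{S}_{14},\mathcal{U}\otimes\mathcal{L})=\Delta$. $DG$ (the double Cayley Grassmannian) is the unique smooth projective $(G_2\times G_2)$-equivariant completion with Picard number one of the group $G_2$, on which $G_2\times G_2$ acts by left and right multiplication. By a result of Ruzzi it is projectively embedded as follows: $Spin_{14}$ has an open orbit in $\mathbb{P}(\Delta)$; for $z\in\Delta$ with $[z]$ in that orbit, the Clifford products $v\cdot z$, $v\in V_{14}$, form a $14$-dimensional subspace $L_z=V_{14}\cdot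 z$ of $\Delta^\vee$, and, with $D_z=L_z^\perp\subset\Delta$ (of dimension $50$), $DG$ is, as a set (equivalently with its reduced structure), the intersection $\mathbb{S}_{14}\cap\mathbb{P}(D_z)$. *)

theory Defs
  imports "HOL-Analysis.Analysis" "HOL-Library.Function_Algebras"
begin

(* The quadratic space of dimension 2n is the hyperbolic one, E \<oplus> E* with dim E = n; over the
   complex numbers every nondegenerate quadratic space of dimension 2n is isometric to it.
   The component Inl i is the coordinate on the basis vector e_i of E, and Inr i the coordinate
   on the dual basis vector f_i of E*. *)
type_synonym 'n quad = "(complex, 'n + 'n) vec"

definition qform :: "'n::finite quad \<Rightarrow> complex" where
  "qform v = (\<Sum>i\<in>UNIV. v $ Inl i * v $ Inr i)"

(* Spinors form the exterior algebra of E. The component I is the coordinate on the wedge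
   product, in increasing order, of the e_i with i in I. *)
type_synonym 'n spinor = "(complex, 'n set) vec"

definition koszul :: "'n::{finite,linorder} \<Rightarrow> 'n set \<Rightarrow> complex" where
  "koszul i I = (-1) ^ card {j \<in> I. j < i}"

(* E acts by exterior multiplication and E* by contraction. *)
definition cliff :: "'n::{finite,linorder} quad \<Rightarrow> 'n spinor \<Rightarrow> 'n spinor" where
  "cliff v x = (\<chi> I. \<Sum>i\<in>UNIV. koszul i I *
     (if i \<in> I then v $ Inl i * x $ (I - {i}) else v $ Inr i * x $ insert i I))"

lemma koszul_remove:
  assumes "j \<in> I"
  shows "koszul i (I - {j}) = (if j < i then - koszul i I else koszul i I)"
proof (cases "j < i")
  case True
  have "{k \<in> I. k < i} = insert j {k \<in> I - {j}. k < i}" using assms True by auto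
  then have "card {k \<in> I. k < i} = Suc (card {k \<in> I - {j}. k < i})" by simp
  then show ?thesis using True by (simp add: koszul_def)
next
  case False
  then have "{k \<in> I - {j}. k < i} = {k \<in> I. k < i}" by auto
  then show ?thesis using False by (simp add: koszul_def)
qed

lemma koszul_insert:
  assumes "j \<notin> I"
  shows "koszul i (insert j I) = (if j < i then - koszul i I else koszul i I)"
  using koszul_remove[of j "insert j I" i] assms by (auto split: if_splits)

lemma koszul_square: "koszul i I * koszul i I = 1"
  by (simp add: koszul_def flip: power_add mult_2)

theorem clifford_relation: "cliff v (cliff v x) = qform v *s x"
proof -
  have "cliff v (cliff v x) $ I = qform v * x $ I" for I
  proof -
    define t where "t = (\<lambda>i j.
      koszul i I * (if i \<in> I then v $ Inl i * (koszul j (I - {i}) *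
          (if j \<in> I - {i} then v $ Inl j * x $ (I - {i} - {j})
           else v $ Inr j * x $ insert j (I - {i})))
        else v $ Inr i * (koszul j (insert i I) *
          (if j \<in> insert i I then v $ Inl j * x $ (insert i I - {j})
           else v $ Inr j * x $ insert j (insert i I)))))"
    have diag: "t i i = v $ Inl i * v $ Inr i * x $ I" for i
    proof -
      have "t i i = (koszul i I * koszul i I) * (v $ Inl i * v $ Inr i * x $ I)"
        by (auto simp: t_def koszul_remove koszul_insert insert_absorb mult_ac)
      then show ?thesis by (simp add: koszul_square)
    qed
    have anti: "t i j = - t j i" if "i \<noteq> j" for i j
    proof -
      have s: "I - {i} - {j} = I - {j} - {i}" "insert i (insert j I) = insert j (insert i I)"
        by auto
      show ?thesis using that
        by (cases "i < j"; cases "i \<in> I"; cases "j \<in> I")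
          (simp_all add: t_def koszul_remove koszul_insert insert_Diff_if s)
    qed
    let ?d = "\<lambda>i j. if i = j then t i i else 0"
    let ?S = "\<Sum>i\<in>UNIV. \<Sum>j\<in>UNIV. t i j - ?d i j"
    have "?S = (\<Sum>j\<in>UNIV. \<Sum>i\<in>UNIV. t i j - ?d i j)" by (rule sum.swap)
    also have "\<dots> = (\<Sum>j\<in>UNIV. \<Sum>i\<in>UNIV. - (t j i - ?d j i))"
    proof (intro sum.cong refl)
      show "t i j - ?d i j = - (t j i - ?d j i)" for i j
        using anti[of i j] by (cases "i = j") simp_all
    qed
    also have "\<dots> = - ?S" by (simp only: sum_negf)
    finally have S: "?S = 0" by simp
    have "cliff v (cliff v x) $ I = (\<Sum>i\<in>UNIV. \<Sum>j\<in>UNIV. t i j)"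
      unfolding cliff_def t_def by (auto simp: sum_distrib_left intro!: sum.cong)
    also have "\<dots> = ?S + (\<Sum>i\<in>UNIV. \<Sum>j\<in>UNIV. ?d i j)"
      by (simp add: sum_subtractf)
    also have "\<dots> = (\<Sum>i\<in>UNIV. t i i)" using S by simp
    also have "\<dots> = qform v * x $ I" by (simp add: diag qform_def sum_distrib_right)
    finally show ?thesis .
  qed
  then show ?thesis by (simp add: vec_eq_iff)
qed

(* half_spin True is the even and half_spin False the odd half-spin representation. *)
definition half_spin :: "bool \<Rightarrow> 'n::finite spinor set" where
  "half_spin p = {x. \<forall>I. x $ I \<noteq> 0 \<longrightarrow> (even (card I) \<longleftrightarrow> p)}"

(* The image of the Spin group in the spin representation. Vectors v with qform v = -1 are not
   needed as generators: such a v is \<i> times a vector of norm 1. *)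
definition spin_group :: "('n::{finite,linorder} spinor \<Rightarrow> 'n spinor) set" where
  "spin_group = {foldr cliff vs | vs. even (length vs) \<and> (\<forall>v\<in>set vs. qform v = 1)}"

(* The coefficient of the top form in rev x \<and> y, where rev is the anti-automorphism of the exterior
   algebra that fixes E. It satisfies pairing (cliff v x) y = pairing x (cliff v y), and for n odd
   it identifies each half-spin representation with the dual of the other one. *)
definition pairing :: "'n::{finite,linorder} spinor \<Rightarrow> 'n spinor \<Rightarrow> complex" where
  "pairing x y = (\<Sum>I\<in>UNIV.
     (-1) ^ (card (- I) * (card (- I) - 1) div 2 + card {(j, i). j \<in> - I \<and> i \<in> I \<and> i < j})
       * x $ (- I) * y $ I)"

definition lines :: "'n::finite spinor set \<Rightarrow> 'n spinor set set" where
  "lines W = {vec.span {y} | y. y \<in> W \<and> y \<noteq> 0}"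

definition taut :: "'n::{finite,linorder} spinor \<Rightarrow> 'n quad set" where
  "taut y = {v. cliff v y = 0}"

definition pure_spinors :: "bool \<Rightarrow> 'n::{finite,linorder} spinor set" where
  "pure_spinors p = {y \<in> half_spin p. y \<noteq> 0 \<and> vec.dim (taut y) = CARD('n)}"

definition spinor_variety :: "bool \<Rightarrow> 'n::{finite,linorder} spinor set set" where
  "spinor_variety p = lines (pure_spinors p)"

inductive_set poly_functions ::
    "(complex \<Rightarrow> 'a \<Rightarrow> 'a) \<Rightarrow> ('a::ab_group_add \<Rightarrow> complex) set"
  for smul :: "complex \<Rightarrow> 'a \<Rightarrow> 'a" where
  const: "(\<lambda>_. c) \<in> poly_functions smul"
| linear: "Vector_Spaces.linear smul (*) f \<Longrightarrow> f \<in> poly_functions smul"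
| add: "f \<in> poly_functions smul \<Longrightarrow> g \<in> poly_functions smul \<Longrightarrow>
    (\<lambda>x. f x + g x) \<in> poly_functions smul"
| mult: "f \<in> poly_functions smul \<Longrightarrow> g \<in> poly_functions smul \<Longrightarrow>
    (\<lambda>x. f x * g x) \<in> poly_functions smul"

(* Zariski open subsets of a linear subspace H; polynomial functions on H are the restrictions of
   those on the ambient space, because linear forms on H extend. *)
definition zariski_open_in ::
    "(complex \<Rightarrow> 'a \<Rightarrow> 'a) \<Rightarrow> 'a::ab_group_add set \<Rightarrow> 'a set \<Rightarrow> bool" where
  "zariski_open_in smul H W \<longleftrightarrow>
     (\<exists>F \<subseteq> poly_functions smul. W = {h \<in> H. \<exists>f\<in>F. f h \<noteq> 0})"

definition homogeneous :: "nat \<Rightarrow> ('n::finite spinor \<Rightarrow> complex) \<Rightarrow> bool" where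
  "homogeneous d f \<longleftrightarrow> f \<in> poly_functions (*s) \<and> (\<forall>c x. f (c *s x) = c ^ d * f x)"

definition zariski_open_proj :: "'n::finite spinor set \<Rightarrow> 'n spinor set set \<Rightarrow> bool" where
  "zariski_open_proj W U \<longleftrightarrow>
     (\<exists>F. (\<forall>f\<in>F. \<exists>d. homogeneous d f) \<and> U = lines {y \<in> W. \<exists>f\<in>F. f y \<noteq> 0})"

definition spin_orbit :: "'n::{finite,linorder} spinor \<Rightarrow> 'n spinor set set" where
  "spin_orbit z = {vec.span {g z} | g. g \<in> spin_group}"

(* The fibre of U \<otimes> L at the line [y] is Hom([y], U_[y]), so a global section is a function s on the
   cone of pure spinors, homogeneous of degree 1, with s y in U_[y] and with components that are
   locally quotients of homogeneous polynomials. The last condition fixes the irrelevant values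
   of s off the cone, so that sections are equal exactly when they are equal as functions. *)
definition sections :: "bool \<Rightarrow> ('n::{finite,linorder} spinor \<Rightarrow> 'n quad) set" where
  "sections p = {s.
     (\<forall>y\<in>pure_spinors p. s y \<in> taut y) \<and>
     (\<forall>y\<in>pure_spinors p. \<forall>c. c \<noteq> 0 \<longrightarrow> s (c *s y) = c *s s y) \<and>
     (\<forall>y0\<in>pure_spinors p. \<exists>d g f. homogeneous d g \<and> (\<forall>k. homogeneous (Suc d) (f k)) \<and>
        g y0 \<noteq> 0 \<and> (\<forall>y\<in>pure_spinors p. g y \<noteq> 0 \<longrightarrow> s y = (\<chi> k. f k y / g y))) \<and>
     (\<forall>y. y \<notin> pure_spinors p \<longrightarrow> s y = 0)}"

definition scale_section ::
    "complex \<Rightarrow> ('n::finite spinor \<Rightarrow> 'n quad) \<Rightarrow> ('n spinor \<Rightarrow> 'n quad)" where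
  "scale_section c s = (\<lambda>y. c *s s y)"

definition zero_locus ::
    "bool \<Rightarrow> ('n::{finite,linorder} spinor \<Rightarrow> 'n quad) \<Rightarrow> 'n spinor set set" where
  "zero_locus p s = lines {y \<in> pure_spinors p. s y = 0}"

(* D_z, the orthogonal in Delta of the subspace V.z of the dual of Delta *)
definition orth_space :: "bool \<Rightarrow> 'n::{finite,linorder} spinor \<Rightarrow> 'n spinor set" where
  "orth_space p z = {y \<in> half_spin p. \<forall>x \<in> range (\<lambda>v. cliff v z). pairing x y = 0}"

definition double_cayley :: "bool \<Rightarrow> 7 spinor \<Rightarrow> 7 spinor set set" where
  "double_cayley p z = spinor_variety p \<inter> lines (orth_space p z)"

definition proj_isomorphic ::
    "'n::finite spinor set \<Rightarrow> 'n spinor set set \<Rightarrow> 'n spinor set set \<Rightarrow> bool" where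
  "proj_isomorphic W X Y \<longleftrightarrow>
     (\<exists>\<phi>. Vector_Spaces.linear (*s) (*s) \<phi> \<and> bij_betw \<phi> W W \<and> (\<lambda>l. \<phi> ` l) ` X = Y)"

end

theory Submission
  imports Defs "HOL-Computational_Algebra.Fundamental_Theorem_Algebra"
begin

text \<open>Write b for the bilinear form of the quadratic form q, U_y for the isotropic space of the pure
spinor y, and <w, y> for the pairing of spinors. Each w in \<Delta> gives a section s_w of U \<otimes> L: since
the Clifford action is self-adjoint for the pairing, the linear form v \<mapsto> <v.w, y> vanishes on U_y, so
it is b(s_w(y), v) for a vector s_w(y) in the orthogonal of U_y, which is U_y itself. By construction
s_w vanishes at y exactly when y lies in D_w, so the zero locus of s_w is the spinor variety cut by
P(D_w). If w is a multiple of g z with g in the spin group, then g carries D_z to D_w and the spinor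
variety to itself, so this locus is projectively isomorphic to the double Cayley Grassmannian. The
spinors w of this kind form a nonempty open set, and it remains to see that every section is some
s_w; then w is a linear coordinate on the space of sections and openness carries over.

That every section is some s_w needs no cohomology: the linear spaces in the spinor variety suffice.
If x is a pure spinor of the other half-spin representation, each v.x is zero or a pure spinor
(cliff_pure), so the vectors v.x form a linear space inside the cone. On a line in the spinor variety
a section is a tuple of sections of O(1), hence linear; so v \<mapsto> s(v.x) is a linear map
(section_linear_on_ruling). This has two consequences.

\<^item> The quadratic form v \<mapsto> b(s(v.x), v) vanishes on isotropic vectors, because v and s(v.x) both lie
  in the isotropic space of v.x. Hence it takes a single value on the vectors of norm 1
  (ruled_linear_norm_eq is the part of this that the argument uses); for s_w the value is <w, x>.
  When x runs over the monomials of one parity, the pairing identifies w with the family of these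
  values, so some s_w has the same values as s. The difference h of s and s_w then vanishes at all
  monomials (ruled_linear_zero_on_units).

\<^item> A pure spinor y that is not a multiple of a monomial lies in a space V.x on which h is already known
  to vanish. Indeed there is an index i such that neither e_i nor f_i annihilates y; put x = e_i.y and
  take u in U_y with b(u, e_i) = 1. Then y = u.x, and by linearity h(y) is a combination of the values
  of h at products of x with basis vectors. The products that occur are annihilated by every basis
  vector that annihilates y and also by e_i or f_i. Induction shows h = 0 (ruled_linear_eq_0).\<close>

section \<open>The Clifford action and the bilinear form\<close>

definition bform :: "'n::finite quad \<Rightarrow> 'n quad \<Rightarrow> complex" where
  "bform u v = (\<Sum>i\<in>UNIV. u $ Inl i * v $ Inr i + u $ Inr i * v $ Inl i)"

definition dual_index :: "'n + 'n \<Rightarrow> 'n + 'n" where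
  "dual_index k = (case k of Inl i \<Rightarrow> Inr i | Inr i \<Rightarrow> Inl i)"

lemma dual_index_simps [simp]:
  "dual_index (Inl i) = Inr i" "dual_index (Inr i) = Inl i" "dual_index (dual_index k) = k"
  by (simp_all add: dual_index_def split: sum.splits)

abbreviation unit :: "'k::finite \<Rightarrow> complex ^ 'k" where
  "unit k \<equiv> axis k 1"

lemma bform_commute: "bform u v = bform v u"
  by (simp add: bform_def algebra_simps)

lemma bform_add_left: "bform (u + u') v = bform u v + bform u' v"
  by (simp add: bform_def algebra_simps sum.distrib)

lemma bform_scale_left: "bform (c *s u) v = c * bform u v"
  by (simp add: bform_def algebra_simps sum_distrib_left)

lemma bform_zero_left [simp]: "bform 0 v = 0"
  by (simp add: bform_def)

lemma bform_add_right: "bform u (v + v') = bform u v + bform u v'"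
  by (simp add: bform_def algebra_simps sum.distrib)

lemma bform_scale_right: "bform u (c *s v) = c * bform u v"
  by (simp add: bform_def algebra_simps sum_distrib_left)

lemma bform_diff_left: "bform (u - u') v = bform u v - bform u' v"
  by (simp add: bform_def algebra_simps sum.distrib sum_subtractf)

lemma qform_add: "qform (u + v) = qform u + qform v + bform u v"
  by (simp add: qform_def bform_def algebra_simps sum.distrib)

lemma qform_scale: "qform (c *s v) = c\<^sup>2 * qform v"
  by (simp add: qform_def power2_eq_square sum_distrib_left algebra_simps)

lemma axis_sum_component [simp]:
  "axis (Inl i) c $ Inl j = (if i = j then c else 0)" "axis (Inr i) c $ Inr j = (if i = j then c else 0)"
  "axis (Inl i) c $ Inr j = 0" "axis (Inr i) c $ Inl j = 0"
  by (auto simp: axis_def)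

lemma axis_component: "axis i c $ j = (if i = j then c else 0)"
  by (auto simp: axis_def)

lemma bform_unit [simp]:
  "bform v (unit (Inl i)) = v $ Inr i" "bform v (unit (Inr i)) = v $ Inl i"
  by (simp_all add: bform_def if_distrib [of "\<lambda>c. _ * c"] cong: if_cong)

lemma bform_unit_dual: "bform v (unit (dual_index k)) = v $ k"
  by (cases k) simp_all

lemma qform_unit [simp]: "qform (unit k) = 0"
  by (cases k) (simp_all add: qform_def)

lemma cliff_add_left: "cliff (u + v) x = cliff u x + cliff v x"
  unfolding vec_eq_iff cliff_def vec_lambda_beta vector_add_component sum.distrib [symmetric]
  by (intro allI sum.cong refl) (simp add: algebra_simps)

lemma cliff_scale_left: "cliff (c *s v) x = c *s cliff v x"
  unfolding vec_eq_iff cliff_def vec_lambda_beta vector_smult_component sum_distrib_left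
  by (intro allI sum.cong refl) simp

lemma cliff_add_right: "cliff v (x + y) = cliff v x + cliff v y"
  unfolding vec_eq_iff cliff_def vec_lambda_beta vector_add_component sum.distrib [symmetric]
  by (intro allI sum.cong refl) (simp add: algebra_simps)

lemma cliff_scale_right: "cliff v (c *s x) = c *s cliff v x"
  unfolding vec_eq_iff cliff_def vec_lambda_beta vector_smult_component sum_distrib_left
  by (intro allI sum.cong refl) simp

lemma linear_vecI:
  assumes "\<And>x y. f (x + y) = f x + f y" "\<And>c x. f (c *s x) = c *s f x"
  shows "Vector_Spaces.linear (*s) (*s) f"
  by (simp add: Vector_Spaces.linear_iff vec.vector_space_axioms assms)

lemma linear_cliff_left: "Vector_Spaces.linear (*s) (*s) (\<lambda>v. cliff v x)"
  by (simp add: linear_vecI cliff_add_left cliff_scale_left)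

lemma linear_cliff_right: "Vector_Spaces.linear (*s) (*s) (cliff v)"
  by (simp add: linear_vecI cliff_add_right cliff_scale_right)

lemma cliff_zero_left [simp]: "cliff 0 x = 0"
  using vec.linear_0 [OF linear_cliff_left] .

lemma cliff_zero_right [simp]: "cliff v 0 = 0"
  using vec.linear_0 [OF linear_cliff_right] .

lemma cliff_diff_left: "cliff (u - v) x = cliff u x - cliff v x"
  using vec.linear_diff [OF linear_cliff_left] .

lemma clifford_polarized: "cliff u (cliff v x) + cliff v (cliff u x) = bform u v *s x"
  using clifford_relation [of "u + v" x] clifford_relation [of u x] clifford_relation [of v x]
  by (simp add: cliff_add_left cliff_add_right qform_add vec.scale_left_distrib algebra_simps)

text \<open>The polarized Clifford relation in the form that moves one vector past another.\<close>

lemma clifford_swap: "cliff u (cliff v x) = bform u v *s x - cliff v (cliff u x)"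
  using clifford_polarized [of u v x] by (simp add: algebra_simps)

lemma cliff_unit_component:
  "cliff (unit (Inl i)) x $ I = (if i \<in> I then koszul i I * x $ (I - {i}) else 0)"
  "cliff (unit (Inr i)) x $ I = (if i \<in> I then 0 else koszul i I * x $ insert i I)"
proof -
  have "cliff (unit (Inl i)) x $ I =
      (\<Sum>j\<in>UNIV. if i = j then (if i \<in> I then koszul i I * x $ (I - {i}) else 0) else 0)"
    unfolding cliff_def vec_lambda_beta by (rule sum.cong) auto
  then show "cliff (unit (Inl i)) x $ I = (if i \<in> I then koszul i I * x $ (I - {i}) else 0)"
    by simp
  have "cliff (unit (Inr i)) x $ I =
      (\<Sum>j\<in>UNIV. if i = j then (if i \<in> I then 0 else koszul i I * x $ insert i I) else 0)"
    unfolding cliff_def vec_lambda_beta by (rule sum.cong) auto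
  then show "cliff (unit (Inr i)) x $ I = (if i \<in> I then 0 else koszul i I * x $ insert i I)"
    by simp
qed

lemma cliff_unit_unit:
  "cliff (unit (Inl i)) (unit J) = (if i \<in> J then 0 else koszul i J *s unit (insert i J))"
  "cliff (unit (Inr i)) (unit J) = (if i \<in> J then koszul i J *s unit (J - {i}) else 0)"
proof -
  have [simp]: "koszul i (insert i K) = koszul i K" "koszul i (K - {i}) = koszul i K" for K
    by (cases "i \<in> K"; simp add: koszul_insert insert_absorb koszul_remove)+
  show "cliff (unit (Inl i)) (unit J) = (if i \<in> J then 0 else koszul i J *s unit (insert i J))"
    by (subst vec_eq_iff) (auto simp: cliff_unit_component axis_component)
  show "cliff (unit (Inr i)) (unit J) = (if i \<in> J then koszul i J *s unit (J - {i}) else 0)"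
    by (subst vec_eq_iff) (auto simp: cliff_unit_component axis_component insert_absorb)
qed

lemma cliff_expansion: "cliff v x = (\<Sum>k\<in>UNIV. v $ k *s cliff (unit k) x)"
proof -
  have "cliff v x = cliff (\<Sum>k\<in>UNIV. v $ k *s unit k) x"
    by (simp add: basis_expansion)
  then show ?thesis
    by (simp add: vec.linear_sum [OF linear_cliff_left] cliff_scale_left)
qed

lemma subspace_half_spin: "vec.subspace (half_spin p)"
proof -
  have "a \<noteq> 0 \<or> b \<noteq> 0" if "a + b \<noteq> 0" for a b :: complex using that by auto
  then show ?thesis
    unfolding vec.subspace_def half_spin_def by simp blast
qed

lemma cliff_half_spin:
  assumes "x \<in> half_spin p"
  shows "cliff v x \<in> half_spin (\<not> p)"
proof -
  have "even (card I) \<longleftrightarrow> \<not> p" if nz: "cliff v x $ I \<noteq> 0" for I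
  proof -
    obtain i where "(if i \<in> I then v $ Inl i * x $ (I - {i}) else v $ Inr i * x $ insert i I) \<noteq> 0"
      using nz unfolding cliff_def by (auto elim!: sum.not_neutral_contains_not_neutral)
    then show ?thesis
      using assms by (cases "i \<in> I") (auto simp: half_spin_def card_Diff_singleton_if card_gt_0_iff)
  qed
  then show ?thesis by (auto simp: half_spin_def)
qed

section \<open>Isotropic spaces of pure spinors\<close>

lemma subspace_taut: "vec.subspace (taut y)"
  by (auto simp: vec.subspace_def taut_def cliff_add_left cliff_scale_left)

lemma taut_isotropic:
  assumes "y \<noteq> 0" "u \<in> taut y" "v \<in> taut y"
  shows "bform u v = 0"
  using clifford_polarized [of u v y] assms by (simp add: taut_def)

text \<open>Complex conjugation composed with the exchange of E and E*. It is chosen so that b(conj_dual u, u) is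
the squared Hermitian norm of u. Positivity then separates the b-orthogonal of a subspace from the
image of that subspace under conj_dual, which bounds the dimension of the orthogonal.\<close>

definition conj_dual :: "'n::finite quad \<Rightarrow> 'n quad" where
  "conj_dual v = (\<chi> k. cnj (v $ dual_index k))"

lemma conj_dual_involution: "conj_dual (conj_dual v) = v"
  by (simp add: conj_dual_def vec_eq_iff split: sum.splits)

lemma conj_dual_add: "conj_dual (u + v) = conj_dual u + conj_dual v"
  by (simp add: conj_dual_def vec_eq_iff)

lemma conj_dual_scale: "conj_dual (c *s v) = cnj c *s conj_dual v"
  by (simp add: conj_dual_def vec_eq_iff)

lemma conj_dual_zero: "conj_dual 0 = 0"
  by (simp add: conj_dual_def vec_eq_iff)

lemma conj_dual_definite:
  assumes "bform (conj_dual u) u = 0"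
  shows "u = 0"
proof -
  have "cnj z * z = of_real ((cmod z)\<^sup>2)" for z
    by (metis complex_norm_square mult.commute)
  then have "bform (conj_dual u) u =
      of_real (\<Sum>i\<in>UNIV. (cmod (u $ Inr i))\<^sup>2 + (cmod (u $ Inl i))\<^sup>2)"
    by (simp add: bform_def conj_dual_def)
  then have "(\<Sum>i\<in>UNIV. (cmod (u $ Inr i))\<^sup>2 + (cmod (u $ Inl i))\<^sup>2) = 0"
    using assms by (metis of_real_eq_0_iff)
  then have "\<forall>i. (cmod (u $ Inr i))\<^sup>2 + (cmod (u $ Inl i))\<^sup>2 = 0"
    by (subst (asm) sum_nonneg_eq_0_iff) auto
  then have "u $ Inl i = 0" "u $ Inr i = 0" for i
    by (simp_all add: add_nonneg_eq_0_iff)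
  then show ?thesis
    by (metis (no_types) sum.exhaust vec_eq_iff zero_index)
qed

lemma subspace_conj_dual:
  assumes "vec.subspace U"
  shows "vec.subspace (conj_dual ` U)"
proof (rule vec.subspaceI)
  show "0 \<in> conj_dual ` U"
    using vec.subspace_0 [OF assms] conj_dual_zero by (metis imageI)
  show "x + y \<in> conj_dual ` U" if "x \<in> conj_dual ` U" "y \<in> conj_dual ` U" for x y
    using that vec.subspace_add [OF assms] by clarify (metis conj_dual_add imageI)
  show "c *s x \<in> conj_dual ` U" if x: "x \<in> conj_dual ` U" for c x
  proof -
    obtain u where "u \<in> U" "x = conj_dual u" using x by auto
    then have "c *s x = conj_dual (cnj c *s u)" "cnj c *s u \<in> U"
      using vec.subspace_scale [OF assms] by (simp_all add: conj_dual_scale)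
    then show ?thesis by simp
  qed
qed

lemma conj_dual_span: "conj_dual ` vec.span B \<subseteq> vec.span (conj_dual ` B)"
proof -
  have "conj_dual u \<in> vec.span (conj_dual ` B)" if "u \<in> vec.span B" for u
    using that
  proof (induction rule: vec.span_induct_alt)
    case base
    then show ?case by (simp add: conj_dual_zero vec.span_zero)
  next
    case (step c x y)
    then show ?case
      by (simp add: conj_dual_add conj_dual_scale vec.span_add vec.span_base vec.span_scale)
  qed
  then show ?thesis by blast
qed

text \<open>The map is only conjugate-linear over the complex numbers, so the invariance of dimension under
linear injections does not apply to it; being an involution, it carries a spanning set of the image
back to one of U.\<close>

lemma dim_conj_dual: "vec.dim U \<le> vec.dim (conj_dual ` U)"
proof -
  obtain B where B: "vec.independent B" "conj_dual ` U \<subseteq> vec.span B"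
      "card B = vec.dim (conj_dual ` U)"
    by (rule vec.basis_exists [of "conj_dual ` U"])
  have "U \<subseteq> conj_dual ` conj_dual ` U"
    by (simp add: conj_dual_involution image_image)
  also have "\<dots> \<subseteq> conj_dual ` vec.span B" using B(2) by (rule image_mono)
  also have "\<dots> \<subseteq> vec.span (conj_dual ` B)" by (rule conj_dual_span)
  finally have "vec.dim U \<le> card (conj_dual ` B)"
    using B(1) by (intro vec.dim_le_card) (simp_all add: vec.finiteI_independent)
  also have "\<dots> \<le> card B"
    using B(1) by (intro card_image_le) (simp add: vec.finiteI_independent)
  finally show ?thesis using B(3) by simp
qed

definition orth :: "'n::finite quad set \<Rightarrow> 'n quad set" where
  "orth U = {v. \<forall>u\<in>U. bform v u = 0}"

lemma subspace_orth: "vec.subspace (orth U)"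
  by (auto simp: vec.subspace_def orth_def bform_add_left bform_scale_left)

text \<open>A vector conj_dual u of the image of U that is orthogonal to U is orthogonal to u, hence 0. So the
image and the orthogonal of U are independent subspaces.\<close>

lemma dim_orth:
  fixes U :: "'n::finite quad set"
  assumes "vec.subspace U"
  shows "vec.dim U + vec.dim (orth U) \<le> 2 * CARD('n)"
proof -
  let ?C = "conj_dual ` U"
  have "orth U \<inter> ?C \<subseteq> {0}"
  proof
    fix v assume "v \<in> orth U \<inter> ?C"
    then obtain u where "v = conj_dual u" "bform v u = 0" by (auto simp: orth_def)
    then have "u = 0" using conj_dual_definite by simp
    then show "v \<in> {0}" using \<open>v = conj_dual u\<close> by (simp add: conj_dual_zero)
  qed
  then have "vec.dim (orth U \<inter> ?C) = 0" by simp
  then have "vec.dim (orth U) + vec.dim ?C = vec.dim {x + y | x y. x \<in> orth U \<and> y \<in> ?C}"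
    using vec.dim_sums_Int [OF subspace_orth subspace_conj_dual [OF assms], of U] by linarith
  also have "\<dots> \<le> 2 * CARD('n)"
    using vec.dim_subset_UNIV [of "{x + y | x y. x \<in> orth U \<and> y \<in> ?C}"]
    by (simp add: card_cart_basis vec.dimension_def)
  finally show ?thesis using dim_conj_dual [of U] by simp
qed

lemma dim_taut_le:
  fixes y :: "'n::{finite,linorder} spinor"
  assumes "y \<noteq> 0"
  shows "vec.dim (taut y) \<le> CARD('n)"
proof -
  have "taut y \<subseteq> orth (taut y)"
    using taut_isotropic [OF assms] by (auto simp: orth_def)
  then show ?thesis
    using dim_orth [OF subspace_taut, of y] vec.dim_subset [of "taut y" "orth (taut y)"] by simp
qed

text \<open>The isotropic space of a pure spinor has half the dimension of the quadratic space, so it is its own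
orthogonal.\<close>

lemma orth_taut_pure:
  assumes "y \<in> pure_spinors p" and "\<forall>u\<in>taut y. bform v u = 0"
  shows "v \<in> taut y"
proof -
  have "taut y \<subseteq> orth (taut y)"
    using taut_isotropic [of y] assms(1) by (auto simp: orth_def pure_spinors_def)
  moreover have "vec.dim (orth (taut y)) \<le> vec.dim (taut y)"
    using dim_orth [OF subspace_taut, of y] assms(1) by (simp add: pure_spinors_def)
  ultimately have "taut y = orth (taut y)"
    by (rule vec.subspace_dim_equal [OF subspace_taut subspace_orth])
  then show ?thesis using assms(2) by (auto simp: orth_def)
qed

text \<open>The isotropic space of v.y is the reflection of U_y in v or, for isotropic v, the span of v and the
part of U_y orthogonal to v. Both cases are covered by one map: v is not in U_y, which is its own orthogonal, so some u0 in U_y has b(u0, v) = 1, and the map T below embeds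
U_y into the annihilator of v.y.\<close>

lemma cliff_pure:
  fixes y :: "'n::{finite,linorder} spinor"
  assumes y: "y \<in> pure_spinors p" and nz: "cliff v y \<noteq> 0"
  shows "cliff v y \<in> pure_spinors (\<not> p)"
proof -
  have "v \<notin> taut y" using nz by (simp add: taut_def)
  \<comment> \<open>Otherwise v would lie in U_y, and v.y would be 0.\<close>
  then obtain u1 where u1: "u1 \<in> taut y" "bform v u1 \<noteq> 0"
    using orth_taut_pure [OF y] by blast
  define u0 where "u0 = (1 / bform v u1) *s u1"
  have u0: "cliff u0 y = 0" "bform u0 v = 1"
    using u1 by (simp_all add: u0_def taut_def cliff_scale_left bform_scale_left bform_commute [of v])
  define a where "a = v - (1 + qform v) *s u0"
  define T where "T = (\<lambda>u. u + bform u v *s a)"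
  have lin: "Vector_Spaces.linear (*s) (*s) T"
    by (intro linear_vecI) (simp_all add: T_def bform_add_left bform_scale_left
        vec.scale_left_distrib vec.scale_right_distrib)
  have T: "T u \<in> taut (cliff v y)" if "u \<in> taut y" for u
  proof -
    have "cliff a (cliff v y) = - y"
      by (simp add: a_def cliff_diff_left cliff_add_left cliff_scale_left clifford_relation
          clifford_swap [of u0 v] u0 vec.scale_left_distrib)
    moreover have "cliff u (cliff v y) = bform u v *s y"
      using that by (simp add: clifford_swap [of u v] taut_def)
    ultimately show ?thesis
      by (simp add: T_def taut_def cliff_add_left cliff_scale_left)
  qed
  have inj: "inj_on T (taut y)"
  proof (rule inj_onI)
    fix u1 u2 assume "u1 \<in> taut y" "u2 \<in> taut y" "T u1 = T u2"
    define u where "u = u1 - u2"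
    have u: "u \<in> taut y" "T u = 0"
      using \<open>u1 \<in> taut y\<close> \<open>u2 \<in> taut y\<close> \<open>T u1 = T u2\<close>
      by (simp_all add: u_def vec.linear_diff [OF lin] vec.subspace_diff [OF subspace_taut])
    have "cliff (T u) y = bform u v *s cliff v y"
      using u(1)
      by (simp add: T_def a_def cliff_add_left cliff_scale_left cliff_diff_left u0 taut_def)
    then have "bform u v = 0" using u nz by simp
    then have "u = 0" using u by (simp add: T_def)
    then show "u1 = u2" by (simp add: u_def)
  qed
  have "vec.span (taut y) = taut y"
    by (simp add: vec.span_eq_iff subspace_taut)
  then have "vec.dim (taut y) = vec.dim (T ` taut y)"
    using vec.dim_image_eq [OF lin, of "taut y"] inj by metis
  also have "\<dots> \<le> vec.dim (taut (cliff v y))"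
    using T by (intro vec.dim_subset) auto
  finally show ?thesis
    using y nz dim_taut_le [OF nz] cliff_half_spin by (auto simp: pure_spinors_def)
qed

lemma taut_scale: "c \<noteq> 0 \<Longrightarrow> taut (c *s y) = taut y"
  by (auto simp: taut_def cliff_scale_right)

lemma pure_scale:
  assumes "y \<in> pure_spinors p" "c \<noteq> 0"
  shows "c *s y \<in> pure_spinors p"
  using assms vec.subspace_scale [OF subspace_half_spin] by (auto simp: pure_spinors_def taut_scale)

lemma pure_unit:
  fixes I :: "'n::{finite,linorder} set"
  shows "unit I \<in> pure_spinors (even (card I))"
proof -
  let ?k = "\<lambda>i. if i \<in> I then Inl i else Inr i :: 'n + 'n"
  let ?B = "range (\<lambda>i. unit (?k i) :: 'n quad)"
  have "card ?B = CARD('n)"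
    by (intro card_image inj_onI) (simp add: axis_eq_axis split: if_splits)
  moreover have "vec.independent ?B"
  proof (rule vec.independent_mono [OF vec.independent_Basis], rule image_subsetI)
    show "unit (?k i) \<in> cart_basis" for i unfolding cart_basis_def by blast
  qed
  moreover have "?B \<subseteq> taut (unit I)"
    by (rule image_subsetI) (simp add: taut_def cliff_unit_unit)
  ultimately have "CARD('n) \<le> vec.dim (taut (unit I))"
    using vec.independent_card_le_dim [of ?B "taut (unit I)"] by simp
  moreover have "(unit I :: 'n spinor) \<noteq> 0" by (simp add: axis_eq_0_iff)
  moreover have "unit I \<in> half_spin (even (card I))"
    by (simp add: half_spin_def axis_def)
  ultimately show ?thesis
    using dim_taut_le [of "unit I"] by (simp add: pure_spinors_def)
qed

section \<open>Sections are linear on lines and on the spaces V.x\<close>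

text \<open>Two rational expressions of one function agree away from finitely many points, hence as fractions of
polynomials. Comparing with the expression valid near t extends the equation to t.\<close>

lemma locally_rational_clear_denominator:
  fixes \<phi> :: "complex \<Rightarrow> complex"
  assumes loc: "\<And>t0. \<exists>F G. poly G t0 \<noteq> 0 \<and> (\<forall>t. poly G t \<noteq> 0 \<longrightarrow> \<phi> t = poly F t / poly G t)"
    and "H \<noteq> 0" and eq: "\<And>t. poly H t \<noteq> 0 \<Longrightarrow> \<phi> t * poly G t = poly F t"
  shows "\<phi> t * poly G t = poly F t"
proof -
  obtain F0 G0 where G0: "poly G0 t \<noteq> 0"
      and F0: "\<And>t'. poly G0 t' \<noteq> 0 \<Longrightarrow> \<phi> t' = poly F0 t' / poly G0 t'"
    using loc [of t] by blast
  have "poly (H * G0 * (F * G0 - F0 * G)) t' = 0" for t'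
  proof (cases "poly H t' = 0 \<or> poly G0 t' = 0")
    case False
    then have "poly F t' * poly G0 t' = \<phi> t' * poly G t' * poly G0 t'"
      using eq by simp
    also have "\<dots> = poly F0 t' * poly G t'"
      using F0 False by simp
    finally show ?thesis by simp
  qed auto
  then have "H * G0 * (F * G0 - F0 * G) = 0"
    using poly_all_0_iff_0 by blast
  then have "F * G0 = F0 * G"
    using \<open>H \<noteq> 0\<close> G0 by auto
  then have "poly F t * poly G0 t = poly F0 t * poly G t"
    by (metis poly_mult)
  also have "\<dots> = \<phi> t * poly G t * poly G0 t"
    using F0 [OF G0] G0 by simp
  finally show ?thesis using G0 by simp
qed

text \<open>A function that is regular at every point of the affine line is a polynomial: a root of the
denominator is also a root of the numerator and can be divided out, so the degree of the denominator
decreases to 0.\<close>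

lemma locally_rational_imp_poly:
  fixes \<phi> :: "complex \<Rightarrow> complex"
  assumes loc: "\<And>t0. \<exists>F G. poly G t0 \<noteq> 0 \<and> (\<forall>t. poly G t \<noteq> 0 \<longrightarrow> \<phi> t = poly F t / poly G t)"
  obtains P where "\<And>t. \<phi> t = poly P t"
proof -
  have "\<exists>P. \<forall>t. \<phi> t = poly P t"
    if "G \<noteq> 0" "\<And>t. \<phi> t * poly G t = poly F t" for F G
    using that
  proof (induction "degree G" arbitrary: F G)
    case 0
    then obtain c where "G = [:c:]" "c \<noteq> 0"
      by (metis degree_eq_zeroE pCons_0_0)
    then have "\<phi> t = poly (smult (1 / c) F) t" for t
      using "0.prems"(2) [of t] by (simp add: field_simps)
    then show ?case by blast
  next
    case (Suc d)
    then obtain r where r: "poly G r = 0"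
      using alg_closed_imp_poly_has_root [of G] by auto
    then obtain G' where G': "G = [:- r, 1:] * G'"
      by (metis dvdE poly_eq_0_iff_dvd)
    have "poly F r = 0" using Suc.prems(2) [of r] r by simp
    then obtain F' where F': "F = [:- r, 1:] * F'"
      by (metis dvdE poly_eq_0_iff_dvd)
    have "G' \<noteq> 0" using Suc.prems(1) G' by auto
    then have "degree G = Suc (degree G')"
      unfolding G' by (subst degree_mult_eq) auto
    moreover have "\<phi> t * poly G' t = poly F' t" for t
    proof (rule locally_rational_clear_denominator [OF loc, of "[:- r, 1:]"])
      show "\<phi> t * poly G' t = poly F' t" if "poly [:- r, 1:] t \<noteq> 0" for t
      proof -
        have "(t - r) * (\<phi> t * poly G' t) = (t - r) * poly F' t"
          using Suc.prems(2) [of t] by (simp add: G' F' algebra_simps)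
        then show ?thesis using that by simp
      qed
    qed simp
    ultimately show ?case
      using Suc.hyps(1) [of G' F'] Suc.hyps(2) \<open>G' \<noteq> 0\<close> by simp
  qed
  moreover obtain F G where FG: "poly G 0 \<noteq> 0" "\<And>t. poly G t \<noteq> 0 \<Longrightarrow> \<phi> t = poly F t / poly G t"
    using loc [of 0] by blast
  moreover have "G \<noteq> 0" using FG by auto
  moreover have "\<phi> t * poly G t = poly F t" for t
    by (rule locally_rational_clear_denominator [OF loc \<open>G \<noteq> 0\<close>]) (simp add: FG(2))
  ultimately show thesis using that by blast
qed

text \<open>P and Q are the expressions in the two affine charts of a section of O(1) on the projective line. Such
a section is P(t) = a + b t with Q(t) = b + a t, and its value at 1 is a + b.\<close>

lemma reciprocal_poly_linear:
  fixes P Q :: "complex poly"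
  assumes PQ: "\<And>t. t \<noteq> 0 \<Longrightarrow> poly P t = t * poly Q (1 / t)"
  shows "poly P 1 = poly P 0 + poly Q 0"
proof -
  let ?m = "degree Q"
  have "poly (monom 1 (Suc ?m) * P) t = poly (monom 1 2 * reflect_poly Q) t" for t
  proof (cases "t = 0")
    case False
    then show ?thesis
      using PQ [of t] poly_reflect_poly_nz [of t Q]
      by (simp add: poly_monom power2_eq_square inverse_eq_divide)
  qed (simp add: poly_monom)
  then have eq: "monom 1 (Suc ?m) * P = monom 1 2 * reflect_poly Q"
    using poly_eq_poly_eq_iff by blast
  \<comment> \<open>Compare degrees: the reflected polynomial has degree at most that of Q.\<close>
  have deg: "degree P \<le> 1"
  proof (cases "P = 0")
    case False
    then have "Suc ?m + degree P = degree (monom 1 (Suc ?m) * P)"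
      by (simp add: degree_mult_eq degree_monom_eq monom_eq_0_iff)
    also have "\<dots> \<le> 2 + ?m"
      unfolding eq using degree_mult_le [of "monom 1 2 :: complex poly" "reflect_poly Q"]
        degree_reflect_poly_le [of Q] by (simp add: degree_monom_eq)
    finally show ?thesis by simp
  qed simp
  define a b where "a = coeff P 0" and "b = coeff P 1"
  have P: "P = [:a, b:]"
    using deg by (intro poly_eqI) (simp add: a_def b_def coeff_pCons coeff_eq_0 split: nat.split)
  have "poly ([:0, 1:] * Q) t = poly ([:0, 1:] * [:b, a:]) t" for t
  proof (cases "t = 0")
    case False
    then show ?thesis
      using PQ [of "1 / t"] by (simp add: P field_simps)
  qed simp
  then have "[:0, 1:] * Q = [:0, 1:] * [:b, a:]"
    using poly_eq_poly_eq_iff by blast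
  then have "Q = [:b, a:]" by simp
  then show ?thesis by (simp add: P)
qed

lemma poly_function_on_line:
  assumes "f \<in> poly_functions (*s)"
  shows "\<exists>P. \<forall>t. f (x + t *s y) = poly P t"
  using assms
proof (induction rule: poly_functions.induct)
  case (const c)
  then show ?case by (intro exI [of _ "[:c:]"]) simp
next
  case (linear f)
  then have "f (x + t *s y) = poly [:f x, f y:] t" for t
    by (simp add: Vector_Spaces.linear_iff)
  then show ?case by blast
next
  case (add f g)
  then obtain P Q where "\<forall>t. f (x + t *s y) = poly P t" "\<forall>t. g (x + t *s y) = poly Q t"
    by blast
  then show ?case by (intro exI [of _ "P + Q"]) simp
next
  case (mult f g)
  then obtain P Q where "\<forall>t. f (x + t *s y) = poly P t" "\<forall>t. g (x + t *s y) = poly Q t"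
    by blast
  then show ?case by (intro exI [of _ "P * Q"]) simp
qed

lemma section_poly_on_line:
  assumes s: "s \<in> sections p" and line: "\<And>t. x + t *s y \<in> pure_spinors p"
  obtains P where "\<And>t. s (x + t *s y) $ k = poly P t"
proof (rule locally_rational_imp_poly)
  fix t0
  obtain d g f where g: "homogeneous d g" and f: "\<And>k. homogeneous (Suc d) (f k)"
      and g0: "g (x + t0 *s y) \<noteq> 0"
      and eq: "\<And>y. y \<in> pure_spinors p \<Longrightarrow> g y \<noteq> 0 \<Longrightarrow> s y = (\<chi> k. f k y / g y)"
  proof -
    have "\<exists>d g f. homogeneous d g \<and> (\<forall>k. homogeneous (Suc d) (f k)) \<and> g (x + t0 *s y) \<noteq> 0 \<and>
        (\<forall>y\<in>pure_spinors p. g y \<noteq> 0 \<longrightarrow> s y = (\<chi> k. f k y / g y))"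
      using s line [of t0] unfolding sections_def by simp
    then show ?thesis using that by blast
  qed
  obtain G where G: "\<And>t. g (x + t *s y) = poly G t"
    using g poly_function_on_line by (metis homogeneous_def)
  obtain F where F: "\<And>t. f k (x + t *s y) = poly F t"
    using f poly_function_on_line by (metis homogeneous_def)
  have "poly G t0 \<noteq> 0" using g0 G by simp
  moreover have "s (x + t *s y) $ k = poly F t / poly G t" if "poly G t \<noteq> 0" for t
    using eq [OF line, of t] that by (simp add: F G)
  ultimately show "\<exists>F G. poly G t0 \<noteq> 0 \<and>
      (\<forall>t. poly G t \<noteq> 0 \<longrightarrow> s (x + t *s y) $ k = poly F t / poly G t)"
    by blast
qed blast

lemma section_homogeneous:
  assumes s: "s \<in> sections p"
  shows "s (c *s y) = c *s s y"
proof -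
  have 0: "s y = 0" if "y \<notin> pure_spinors p" for y
    using s that by (simp add: sections_def)
  consider "c = 0" | "c \<noteq> 0" "y \<in> pure_spinors p" | "c \<noteq> 0" "y \<notin> pure_spinors p" by blast
  then show ?thesis
  proof cases
    case 1
    then show ?thesis using 0 [of 0] by (simp add: pure_spinors_def)
  next
    case 2
    then show ?thesis using s by (simp add: sections_def)
  next
    case 3
    have "c *s y \<notin> pure_spinors p"
      using pure_scale [of "c *s y" p "1 / c"] 3 by auto
    then show ?thesis using 0 3 by simp
  qed
qed

text \<open>A plane in the cone is a line in the spinor variety. There each component of the section restricts
to a section of O(1), so it is a linear form on the plane. Dependent x and y are settled by
homogeneity.\<close>

lemma section_add_on_plane:
  assumes s: "s \<in> sections p"
    and plane: "\<And>a b. a *s x + b *s y \<noteq> 0 \<Longrightarrow> a *s x + b *s y \<in> pure_spinors p"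
  shows "s (x + y) = s x + s y"
proof (cases "\<exists>a b. (a \<noteq> 0 \<or> b \<noteq> 0) \<and> a *s x + b *s y = 0")
  case True
  then obtain a b where ab: "a \<noteq> 0 \<or> b \<noteq> 0" "a *s x + b *s y = 0" by blast
  have dep: "s (x + y) = s x + s y" if "a \<noteq> 0" "a *s x + b *s y = 0" for a b x y
  proof -
    have "x = (1 / a) *s (a *s x)" using that by simp
    also have "a *s x = - (b *s y)" using that(2) by (simp add: eq_neg_iff_add_eq_0)
    finally have x: "x = (- b / a) *s y" by simp
    then have "x + y = (- b / a + 1) *s y"
      by (simp only: vec.scale_left_distrib vec.scale_one)
    then have "s (x + y) = (- b / a) *s s y + s y"
      by (metis section_homogeneous [OF s] vec.scale_left_distrib vec.scale_one)
    then show ?thesis by (simp only: x section_homogeneous [OF s])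
  qed
  show ?thesis
    using ab dep [of a x b y] dep [of b y a x] by (auto simp: add.commute)
next
  case False
  then have line: "x + t *s y \<in> pure_spinors p" "y + t *s x \<in> pure_spinors p" for t
    using plane [of 1 t] plane [of t 1]
    by (metis add.commute vec.scale_one zero_neq_one)+
  have "s (x + y) $ k = s x $ k + s y $ k" for k
  proof -
    obtain P where P: "\<And>t. s (x + t *s y) $ k = poly P t"
      using section_poly_on_line [OF s line(1)] by blast
    obtain Q where Q: "\<And>t. s (y + t *s x) $ k = poly Q t"
      using section_poly_on_line [OF s line(2)] by blast
    have "poly P t = t * poly Q (1 / t)" if "t \<noteq> 0" for t
    proof -
      have "x + t *s y = t *s (y + (1 / t) *s x)"
        using that by (simp add: vec.scale_right_distrib)
      then show ?thesis
        unfolding P [symmetric] Q [symmetric] by (simp only: section_homogeneous [OF s] vector_smult_component)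
    qed
    then have "poly P 1 = poly P 0 + poly Q 0" by (rule reciprocal_poly_linear)
    then show ?thesis by (simp flip: P Q)
  qed
  then show ?thesis by (simp add: vec_eq_iff)
qed

lemma section_linear_on_ruling:
  assumes s: "s \<in> sections p" and x: "x \<in> pure_spinors (\<not> p)"
  shows "Vector_Spaces.linear (*s) (*s) (\<lambda>v. s (cliff v x))"
proof (rule linear_vecI)
  fix u v c
  show "s (cliff (c *s v) x) = c *s s (cliff v x)"
    by (simp add: cliff_scale_left section_homogeneous [OF s])
  have "s (cliff u x + cliff v x) = s (cliff u x) + s (cliff v x)"
  proof (rule section_add_on_plane [OF s])
    fix a b
    have eq: "a *s cliff u x + b *s cliff v x = cliff (a *s u + b *s v) x"
      by (simp add: cliff_add_left cliff_scale_left)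
    show "a *s cliff u x + b *s cliff v x \<in> pure_spinors p" if "a *s cliff u x + b *s cliff v x \<noteq> 0"
      using cliff_pure [OF x] that unfolding eq by auto
  qed
  then show "s (cliff (u + v) x) = s (cliff u x) + s (cliff v x)"
    by (simp add: cliff_add_left)
qed

section \<open>Vanishing of sections from their values at monomials\<close>

text \<open>The properties of sections on which the rest depends. Unlike the local description by quotients
they pass to differences without finding common denominators.\<close>

definition ruled_linear :: "bool \<Rightarrow> ('n::{finite,linorder} spinor \<Rightarrow> 'n quad) \<Rightarrow> bool" where
  "ruled_linear p h \<longleftrightarrow> (\<forall>c y. h (c *s y) = c *s h y) \<and>
     (\<forall>x\<in>pure_spinors (\<not> p). Vector_Spaces.linear (*s) (*s) (\<lambda>v. h (cliff v x))) \<and>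
     (\<forall>y\<in>pure_spinors p. h y \<in> taut y)"

lemma ruled_linearD:
  assumes "ruled_linear p h"
  shows "h (c *s y) = c *s h y"
    and "x \<in> pure_spinors (\<not> p) \<Longrightarrow> Vector_Spaces.linear (*s) (*s) (\<lambda>v. h (cliff v x))"
    and "y \<in> pure_spinors p \<Longrightarrow> h y \<in> taut y"
  using assms by (auto simp: ruled_linear_def)

lemma ruled_linear_diff:
  assumes "ruled_linear p h" "ruled_linear p h'"
  shows "ruled_linear p (\<lambda>y. h y - h' y)"
  unfolding ruled_linear_def
proof (intro conjI allI ballI)
  show "h (c *s y) - h' (c *s y) = c *s (h y - h' y)" for c y
    by (simp add: assms [THEN ruled_linearD(1)] vec.scale_right_diff_distrib)
  show "Vector_Spaces.linear (*s) (*s) (\<lambda>v. h (cliff v x) - h' (cliff v x))"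
    if "x \<in> pure_spinors (\<not> p)" for x
    using vec.linear_compose_sub assms [THEN ruled_linearD(2), OF that] .
  show "h y - h' y \<in> taut y" if "y \<in> pure_spinors p" for y
    using vec.subspace_diff [OF subspace_taut] assms [THEN ruled_linearD(3), OF that] .
qed

lemma section_ruled_linear:
  assumes "s \<in> sections p"
  shows "ruled_linear p s"
  unfolding ruled_linear_def
  using assms section_homogeneous [OF assms] section_linear_on_ruling [OF assms]
  by (auto simp: sections_def)

text \<open>An isotropic v annihilates v.x, so v and h(v.x) both lie in the isotropic space of v.x.\<close>

lemma ruled_linear_orthogonal:
  assumes h: "ruled_linear p h" and x: "x \<in> pure_spinors (\<not> p)" and v: "qform v = 0"
  shows "bform (h (cliff v x)) v = 0"
proof (cases "cliff v x = 0")
  case True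
  then show ?thesis using ruled_linearD(1) [OF h, of 0 0] by simp
next
  case False
  then have pure: "cliff v x \<in> pure_spinors p" using cliff_pure [OF x] by simp
  have "v \<in> taut (cliff v x)" using v by (simp add: taut_def clifford_relation)
  then show ?thesis
    using taut_isotropic [OF False] ruled_linearD(3) [OF h pure] by blast
qed

text \<open>The vectors u + \<i> v and u - \<i> v are isotropic. The quadratic form v \<mapsto> b(h(v.x), v)
vanishes at both; adding the two equations cancels the mixed terms and leaves the claim.\<close>

lemma ruled_linear_norm_eq:
  assumes h: "ruled_linear p h" and x: "x \<in> pure_spinors (\<not> p)"
    and uv: "qform u = 1" "qform v = 1" "bform u v = 0"
  shows "bform (h (cliff u x)) u = bform (h (cliff v x)) v"
proof -
  note lin = ruled_linearD(2) [OF h x]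
  define B where "B = (\<lambda>u v. bform (h (cliff u x)) v)"
  have "B u u + c * (B u v + B v u) - B v v = 0" if "c\<^sup>2 = -1" for c
  proof -
    have "qform (u + c *s v) = 0"
      using uv that by (simp add: qform_add qform_scale bform_scale_right)
    then have "B (u + c *s v) (u + c *s v) = 0"
      unfolding B_def by (rule ruled_linear_orthogonal [OF h x])
    also have "B (u + c *s v) (u + c *s v) = B u u + c * (B u v + B v u) + c\<^sup>2 * B v v"
      unfolding B_def vec.linear_add [OF lin] vec.linear_scale [OF lin]
      by (simp add: bform_add_left bform_add_right bform_scale_left bform_scale_right
          algebra_simps power2_eq_square)
    finally show ?thesis using that by simp
  qed
  from this [of \<i>] this [of "- \<i>"] have "2 * (B u u - B v v) = 0"
    by (simp add: algebra_simps)
  then show ?thesis by (simp add: B_def)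
qed

abbreviation hyperbolic_unit :: "'n::finite \<Rightarrow> 'n quad" where
  "hyperbolic_unit i \<equiv> unit (Inl i) + unit (Inr i)"

lemma qform_hyperbolic_unit: "qform (hyperbolic_unit i) = 1"
  by (simp add: qform_add)

lemma bform_hyperbolic_unit: "i \<noteq> j \<Longrightarrow> bform (hyperbolic_unit i) (hyperbolic_unit j) = 0"
  by (simp add: bform_add_right)

lemma ruled_linear_norm_unit:
  assumes "ruled_linear p h" "x \<in> pure_spinors (\<not> p)"
  shows "bform (h (cliff (hyperbolic_unit i) x)) (hyperbolic_unit i) =
    bform (h (cliff (hyperbolic_unit j) x)) (hyperbolic_unit j)"
  using ruled_linear_norm_eq [OF assms qform_hyperbolic_unit qform_hyperbolic_unit]
    bform_hyperbolic_unit by (cases "i = j") auto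

lemma taut_unit:
  "unit (if i \<in> I then Inl i else Inr i) \<in> taut (unit I)"
  by (simp add: taut_def cliff_unit_unit)

text \<open>The monomial of I is, up to sign, the product of e_i + f_i with the monomial of the set J obtained by
adding or removing i. So the norm condition at J gives one equation between the components of
h(unit I) at e_i and f_i, and one of the two vanishes since h(unit I) lies in the isotropic space
spanned by the e_i with i in I and the f_i with i outside I.\<close>

lemma ruled_linear_zero_on_units:
  fixes h :: "'n::{finite,linorder} spinor \<Rightarrow> 'n quad"
  assumes h: "ruled_linear p h"
    and norm: "\<And>J i. even (card J) \<longleftrightarrow> \<not> p \<Longrightarrow>
      bform (h (cliff (hyperbolic_unit i) (unit J))) (hyperbolic_unit i) = 0"
    and I: "even (card I) \<longleftrightarrow> p"
  shows "h (unit I) = 0"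
proof -
  have nz: "(unit I :: 'n spinor) \<noteq> 0" by (simp add: axis_eq_0_iff)
  have "unit I \<in> pure_spinors p" using pure_unit [of I] I by simp
  then have taut: "h (unit I) \<in> taut (unit I)" using ruled_linearD(3) [OF h] by blast
  have "h (unit I) $ Inl i = 0 \<and> h (unit I) $ Inr i = 0" for i
  proof -
    define J where "J = (if i \<in> I then I - {i} else insert i I)"
    have J: "even (card J) \<longleftrightarrow> \<not> p"
      using I by (auto simp: J_def card_Diff_singleton_if card_gt_0_iff)
    have kJ: "koszul i J \<noteq> 0" by (simp add: koszul_def)
    have "cliff (hyperbolic_unit i) (unit J) = koszul i J *s unit I"
      by (auto simp: cliff_add_left cliff_unit_unit J_def insert_absorb)
    then have "koszul i J * (h (unit I) $ Inl i + h (unit I) $ Inr i) = 0"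
      using norm [OF J, of i] ruled_linearD(1) [OF h]
      by (simp add: bform_scale_left bform_add_right add.commute distrib_left)
    then have "h (unit I) $ Inl i + h (unit I) $ Inr i = 0"
      using kJ mult_eq_0_iff by blast
    moreover have "h (unit I) $ (if i \<in> I then Inr i else Inl i) = 0"
      using taut_isotropic [OF nz taut taut_unit [of i]] by (auto split: if_splits)
    ultimately show ?thesis by (auto split: if_splits)
  qed
  then show ?thesis by (metis (no_types) sum.exhaust vec_eq_iff zero_index)
qed

text \<open>The number of indices at which a spinor is not split measures its distance from the monomials in the
induction below: a nonzero spinor is split at every index exactly when it is a multiple of a
monomial.\<close>

definition split_at :: "'n::{finite,linorder} spinor \<Rightarrow> 'n \<Rightarrow> bool" where
  "split_at y i \<longleftrightarrow> unit (Inl i) \<in> taut y \<or> unit (Inr i) \<in> taut y"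

lemma split_everywhere_unit:
  fixes y :: "'n::{finite,linorder} spinor"
  assumes "\<And>i. split_at y i"
  shows "\<exists>I. y = y $ I *s unit I"
proof (intro exI)
  let ?I = "{i. unit (Inl i) \<in> taut y}"
  have "y $ J = 0" if "J \<noteq> ?I" for J
  proof -
    have "\<exists>i. (i \<in> J) \<noteq> (i \<in> ?I)" using that by (simp add: set_eq_iff)
    then obtain i where "(i \<in> J) \<noteq> (i \<in> ?I)" by (rule exE)
    then consider "i \<notin> J" "unit (Inl i) \<in> taut y" | "i \<in> J" "unit (Inr i) \<in> taut y"
      using assms [of i] by (auto simp: split_at_def)
    then show ?thesis
    proof cases
      case 1
      then have "cliff (unit (Inl i)) y $ insert i J = 0" by (simp add: taut_def)
      then show ?thesis using 1 by (simp add: cliff_unit_component koszul_def)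
    next
      case 2
      then have "cliff (unit (Inr i)) y $ (J - {i}) = 0" by (simp add: taut_def)
      then show ?thesis using 2 by (simp add: cliff_unit_component koszul_def insert_absorb)
    qed
  qed
  then show "y = y $ ?I *s unit ?I"
    by (subst vec_eq_iff) (simp add: axis_component)
qed

text \<open>If y is not split at i, then y = u.x with x = e_i.y and u in U_y, b(u, e_i) = 1. Expanding u in basis
vectors b_k and using linearity on the space V.x, it suffices to treat the products b_k.x whose
coefficient in u is nonzero. They are split at i, and at every index where y is split: if b_l
annihilates y, then b_l is not f_i and so anticommutes with e_i; and the coefficient of u at the
basis vector dual to b_l is b(u, b_l) = 0, so b_l anticommutes with each b_k that occurs.\<close>

lemma ruled_linear_eq_0:
  fixes h :: "'n::{finite,linorder} spinor \<Rightarrow> 'n quad"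
  assumes h: "ruled_linear p h"
    and units: "\<And>I. even (card I) \<longleftrightarrow> p \<Longrightarrow> h (unit I) = 0"
    and "y \<in> pure_spinors p"
  shows "h y = 0"
  using \<open>y \<in> pure_spinors p\<close>
proof (induction "card {i. \<not> split_at y i}" arbitrary: y rule: less_induct)
  case less
  have nz: "y \<noteq> 0" using less.prems by (simp add: pure_spinors_def)
  show ?case
  proof (cases "\<exists>i. \<not> split_at y i")
    case False
    then obtain I where I: "y = y $ I *s unit I" using split_everywhere_unit by blast
    then have "y $ I \<noteq> 0" using nz by auto
    then have "even (card I) \<longleftrightarrow> p"
      using less.prems by (simp add: pure_spinors_def half_spin_def)
    then show ?thesis using I ruled_linearD(1) [OF h] units by (metis vec.scale_zero_right)
  next
    case True
    then obtain i where i: "\<not> split_at y i" by blast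
    define x where "x = cliff (unit (Inl i)) y"
    have "x \<noteq> 0" using i by (simp add: x_def split_at_def taut_def)
    then have x: "x \<in> pure_spinors (\<not> p)" unfolding x_def by (rule cliff_pure [OF less.prems])
    \<comment> \<open>Otherwise e_i would lie in the self-orthogonal space U_y.\<close>
    obtain u1 where u1: "u1 \<in> taut y" "bform (unit (Inl i)) u1 \<noteq> 0"
      using orth_taut_pure [OF less.prems, of "unit (Inl i)"] i by (auto simp: split_at_def)
    define u where "u = (1 / bform (unit (Inl i)) u1) *s u1"
    have u: "u \<in> taut y" "bform u (unit (Inl i)) = 1"
      using u1 vec.subspace_scale [OF subspace_taut]
      by (simp_all add: u_def bform_scale_left bform_commute [of u1] del: bform_unit)
    have y: "y = cliff u x"
      using u by (simp add: x_def clifford_swap [of u "unit (Inl i)"] taut_def del: bform_unit)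
    have summand: "u $ k *s h (cliff (unit k) x) = 0" for k
    proof (cases "u $ k = 0 \<or> cliff (unit k) x = 0")
      case True
      then show ?thesis using ruled_linearD(1) [OF h, of 0 0] by auto
    next
      case False
      let ?z = "cliff (unit k) x"
      have "unit l \<in> taut ?z" if l: "unit l \<in> taut y" for l
      proof -
        have "l \<noteq> Inr i" using l i by (auto simp: split_at_def)
        then have "bform (unit l) (unit (Inl i)) = 0"
          by (cases l) auto
        then have "cliff (unit l) x = 0"
          using l by (simp add: x_def clifford_swap [of "unit l" "unit (Inl i)"] taut_def
              del: bform_unit)
        moreover have "bform (unit l) (unit k) = 0"
        proof -
          have "bform u (unit l) = 0" using taut_isotropic [OF nz u(1) l] .
          then have "u $ dual_index l = 0" using bform_unit_dual [of u "dual_index l"] by simp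
          then have "k \<noteq> dual_index l" using False by auto
          then show ?thesis by (cases k; cases l) auto
        qed
        ultimately show ?thesis
          by (simp add: taut_def clifford_swap [of "unit l" "unit k"] del: bform_unit)
      qed
      then have "split_at ?z j" if "split_at y j" for j
        using that by (auto simp: split_at_def)
      moreover have "split_at ?z i"
      proof (cases "k = Inr i")
        case True
        then show ?thesis by (simp add: split_at_def taut_def clifford_relation)
      next
        case False
        then have "bform (unit (Inl i)) (unit k) = 0" by (cases k) auto
        then have "cliff (unit (Inl i)) ?z = 0"
          by (simp add: x_def clifford_swap [of "unit (Inl i)" "unit k"] clifford_relation
              del: bform_unit)
        then show ?thesis by (simp add: split_at_def taut_def)
      qed
      ultimately have "{j. \<not> split_at ?z j} \<subset> {j. \<not> split_at y j}" using i by blast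
      then have "card {j. \<not> split_at ?z j} < card {j. \<not> split_at y j}"
        by (intro psubset_card_mono) simp_all
      moreover have "?z \<in> pure_spinors p" using cliff_pure [OF x] False by simp
      ultimately show ?thesis using less.hyps by simp
    qed
    have "h y = h (cliff (\<Sum>k\<in>UNIV. u $ k *s unit k) x)"
      by (simp add: y basis_expansion)
    also have "\<dots> = (\<Sum>k\<in>UNIV. u $ k *s h (cliff (unit k) x))"
      using vec.linear_sum [OF ruled_linearD(2) [OF h x], of "\<lambda>k. u $ k *s unit k" UNIV]
      by (simp only: vec.linear_scale [OF ruled_linearD(2) [OF h x]])
    finally show ?thesis using summand by simp
  qed
qed

section \<open>The pairing and the sections attached to spinors\<close>

definition top_sign :: "'n::{finite,linorder} set \<Rightarrow> complex" where
  "top_sign I =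
     (-1) ^ (card (- I) * (card (- I) - 1) div 2 + card {(j, i). j \<in> - I \<and> i \<in> I \<and> i < j})"

lemma pairing_top_sign: "pairing x y = (\<Sum>I\<in>UNIV. top_sign I * x $ (- I) * y $ I)"
  by (simp add: pairing_def top_sign_def)

lemma top_sign_nonzero: "top_sign I \<noteq> 0"
  by (simp add: top_sign_def)

text \<open>Adding i to I lowers the number m of elements outside I by one and so m (m - 1) / 2 by m - 1. In the
inversion count the pairs of i with smaller elements of I are lost, and the pairs of i with larger
elements outside I are gained. Modulo 2 the total change is the number of elements below i, inside
and outside I, which is the sum of the exponents of the two Koszul signs.\<close>

lemma top_sign_insert:
  fixes i :: "'n::{finite,linorder}"
  assumes "i \<notin> I"
  shows "top_sign I * koszul i (- I) = top_sign (insert i I) * koszul i I"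
proof -
  let ?I' = "insert i I"
  let ?inv = "\<lambda>I. {(j, i). j \<in> - I \<and> i \<in> I \<and> i < (j::'n)}"
  let ?m = "card (- ?I')"
  let ?a = "card {j \<in> I. j < i}" and ?b = "card {j \<in> - I. j < i}"
  let ?c = "card {j \<in> - ?I'. i < j}"
  have "- I = insert i (- ?I')" using assms by auto
  then have m: "card (- I) = Suc ?m" by simp
  have "card (- ?I') = card ({j \<in> - I. j < i} \<union> {j \<in> - ?I'. i < j})"
    using assms by (intro arg_cong [of _ _ card]) auto
  moreover have "card ({j \<in> - I. j < i} \<union> {j \<in> - ?I'. i < j}) = ?b + ?c"
    by (rule card_Un_disjoint) auto
  ultimately have bc: "?m = ?b + ?c" by (rule trans)
  have "?inv ?I' \<union> {i} \<times> {j \<in> I. j < i} = ?inv I \<union> {j \<in> - ?I'. i < j} \<times> {i}"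
    using assms by auto
  moreover have "card (?inv ?I' \<union> {i} \<times> {j \<in> I. j < i}) =
      card (?inv ?I') + card ({i} \<times> {j \<in> I. j < i})"
    by (rule card_Un_disjoint) auto
  moreover have "card (?inv I \<union> {j \<in> - ?I'. i < j} \<times> {i}) =
      card (?inv I) + card ({j \<in> - ?I'. i < j} \<times> {i})"
    using assms by (intro card_Un_disjoint) auto
  ultimately have "card (?inv ?I') + card ({i} \<times> {j \<in> I. j < i}) =
      card (?inv I) + card ({j \<in> - ?I'. i < j} \<times> {i})"
    by (simp only:)
  then have inv: "card (?inv ?I') + ?a = card (?inv I) + ?c"
    by (simp add: card_cartesian_product)
  have tri: "Suc ?m * (Suc ?m - 1) div 2 = ?m * (?m - 1) div 2 + ?m"
    by (cases ?m) auto
  have "top_sign I * koszul i (- I) =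
      (-1) ^ (?m * (?m - 1) div 2 + (card (?inv I) + ?c) + 2 * ?b)"
    unfolding top_sign_def koszul_def m tri by (simp add: bc power_add mult_2)
  also have "\<dots> = (-1) ^ (?m * (?m - 1) div 2 + (card (?inv ?I') + ?a))"
    unfolding inv by (simp add: power_add)
  also have "\<dots> = top_sign ?I' * koszul i I"
    by (simp add: top_sign_def koszul_def power_add)
  finally show ?thesis .
qed

lemma top_sign_insert':
  assumes "i \<notin> I"
  shows "top_sign (insert i I) * koszul i (- I) = top_sign I * koszul i I"
  using top_sign_insert [OF assms] koszul_square [of i I] koszul_square [of i "- I"] by algebra

lemma pairing_add_left: "pairing (x + x') y = pairing x y + pairing x' y"
  by (simp add: pairing_top_sign algebra_simps sum.distrib)

lemma pairing_add_right: "pairing x (y + y') = pairing x y + pairing x y'"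
  by (simp add: pairing_top_sign algebra_simps sum.distrib)

lemma pairing_scale_left: "pairing (c *s x) y = c * pairing x y"
  by (simp add: pairing_top_sign sum_distrib_left algebra_simps)

lemma pairing_scale_right: "pairing x (c *s y) = c * pairing x y"
  by (simp add: pairing_top_sign sum_distrib_left algebra_simps)

lemma pairing_zero [simp]: "pairing 0 y = 0" "pairing x 0 = 0"
  by (simp_all add: pairing_top_sign)

lemma pairing_sum_left: "pairing (\<Sum>k\<in>A. f k) y = (\<Sum>k\<in>A. pairing (f k) y)"
  by (induction A rule: infinite_finite_induct) (simp_all add: pairing_add_left)

lemma pairing_sum_right: "pairing x (\<Sum>k\<in>A. f k) = (\<Sum>k\<in>A. pairing x (f k))"
  by (induction A rule: infinite_finite_induct) (simp_all add: pairing_add_right)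

lemma pairing_unit: "pairing w (unit J) = top_sign J * w $ (- J)"
proof -
  have "pairing w (unit J) = (\<Sum>I\<in>UNIV. if I = J then top_sign J * w $ (- J) else 0)"
    unfolding pairing_top_sign by (rule sum.cong) (auto simp: axis_component)
  then show ?thesis by simp
qed

lemma pairing_cliff_unit: "pairing (cliff (unit k) x) y = pairing x (cliff (unit k) y)"
proof (cases k)
  case (Inl i)
  have "pairing (cliff (unit (Inl i)) x) y =
      (\<Sum>I | i \<notin> I. top_sign I * koszul i (- I) * x $ (- insert i I) * y $ I)"
    unfolding pairing_top_sign cliff_unit_component
    by (rule sum.mono_neutral_cong_right) (auto simp: Compl_insert)
  also have "\<dots> = (\<Sum>I | i \<notin> I. top_sign (insert i I) * koszul i I * x $ (- insert i I) * y $ I)"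
    by (rule sum.cong) (simp_all add: top_sign_insert)
  also have "\<dots> = (\<Sum>I | i \<in> I. top_sign I * x $ (- I) * (koszul i I * y $ (I - {i})))"
    by (rule sum.reindex_bij_witness [of _ "\<lambda>I. I - {i}" "insert i"])
      (auto simp: koszul_remove insert_absorb koszul_insert)
  also have "\<dots> = pairing x (cliff (unit (Inl i)) y)"
    unfolding pairing_top_sign cliff_unit_component
    by (rule sum.mono_neutral_cong_left) auto
  finally show ?thesis using Inl by simp
next
  case (Inr i)
  let ?f = "\<lambda>I. top_sign I * koszul i (- I) * x $ insert i (- I) * y $ I"
  have "pairing (cliff (unit (Inr i)) x) y = (\<Sum>I | i \<in> I. ?f I)"
    unfolding pairing_top_sign cliff_unit_component
    by (rule sum.mono_neutral_cong_right) auto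
  also have "\<dots> = (\<Sum>I | i \<notin> I. ?f (insert i I))"
    by (rule sum.reindex_bij_witness [of _ "insert i" "\<lambda>I. I - {i}"]) (auto simp: insert_absorb)
  also have "\<dots> = (\<Sum>I | i \<notin> I. top_sign I * x $ (- I) * (koszul i I * y $ insert i I))"
  proof (rule sum.cong [OF refl])
    fix I assume "I \<in> {I. i \<notin> I}"
    then have I: "i \<notin> I" by simp
    then have eq: "insert i (- insert i I) = - I" "koszul i (- insert i I) = koszul i (- I)"
      by (auto simp: Compl_insert koszul_remove)
    show "?f (insert i I) = top_sign I * x $ (- I) * (koszul i I * y $ insert i I)"
      by (simp add: eq top_sign_insert' [OF I])
  qed
  also have "\<dots> = pairing x (cliff (unit (Inr i)) y)"
    unfolding pairing_top_sign cliff_unit_component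
    by (rule sum.mono_neutral_cong_left) auto
  finally show ?thesis using Inr by simp
qed

lemma pairing_cliff: "pairing (cliff v x) y = pairing x (cliff v y)"
  unfolding cliff_expansion [of v]
  by (simp add: pairing_sum_left pairing_sum_right pairing_scale_left pairing_scale_right
      pairing_cliff_unit)

text \<open>The vector that represents v \<mapsto> <v.w, y> through the bilinear form: its coordinate at a basis
vector is its product with the dual basis vector.\<close>

definition spinor_section :: "bool \<Rightarrow> 'n::{finite,linorder} spinor \<Rightarrow> 'n spinor \<Rightarrow> 'n quad" where
  "spinor_section p w y =
     (if y \<in> pure_spinors p then \<chi> k. pairing (cliff (unit (dual_index k)) w) y else 0)"

lemma bform_expansion: "bform u v = (\<Sum>k\<in>UNIV. v $ k * bform u (unit k))"
proof -
  have "bform u (\<Sum>k\<in>A. v $ k *s unit k) = (\<Sum>k\<in>A. v $ k * bform u (unit k))" for A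
    by (induction A rule: infinite_finite_induct)
      (simp_all add: bform_add_right bform_scale_right bform_commute [of u 0] del: bform_unit)
  from this [of UNIV] show ?thesis by (simp only: basis_expansion)
qed

lemma bform_spinor_section:
  assumes "y \<in> pure_spinors p"
  shows "bform (spinor_section p w y) v = pairing (cliff v w) y"
proof -
  have unit: "bform (spinor_section p w y) (unit k) = pairing (cliff (unit k) w) y" for k
    using bform_unit_dual [of "spinor_section p w y" "dual_index k"] assms
    by (simp add: spinor_section_def)
  show ?thesis
    unfolding bform_expansion [of _ v] cliff_expansion [of v] pairing_sum_left pairing_scale_left
      unit ..
qed

lemma linear_functional_pairing: "Vector_Spaces.linear (*s) (*) (pairing x)"
proof -
  have "vector_space ((*) :: complex \<Rightarrow> complex \<Rightarrow> complex)"
    by unfold_locales (simp_all add: algebra_simps)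
  then show ?thesis
    by (simp add: Vector_Spaces.linear_iff vec.vector_space_axioms pairing_add_right
        pairing_scale_right)
qed

text \<open>The value lies in the orthogonal of U_y, which is U_y: if v annihilates y, then
<v.w, y> = <w, v.y> = 0. The components are linear forms in y, quotients with denominator 1.\<close>

lemma spinor_section_in_sections:
  fixes w :: "'n::{finite,linorder} spinor"
  shows "spinor_section p w \<in> sections p"
  unfolding sections_def mem_Collect_eq
proof (intro conjI ballI allI impI)
  fix y :: "'n spinor" assume y: "y \<in> pure_spinors p"
  have "bform (spinor_section p w y) v = 0" if "v \<in> taut y" for v
    using that by (simp add: bform_spinor_section [OF y] pairing_cliff taut_def)
  then show "spinor_section p w y \<in> taut y" using orth_taut_pure [OF y] by blast
  show "spinor_section p w (c *s y) = c *s spinor_section p w y" if "c \<noteq> 0" for c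
    using y pure_scale [OF y that]
    by (simp add: spinor_section_def vec_eq_iff pairing_scale_right)
  let ?f = "\<lambda>k. pairing (cliff (unit (dual_index k)) w)"
  have "homogeneous 0 (\<lambda>_. 1)"
    by (simp add: homogeneous_def poly_functions.const)
  moreover have "\<forall>k. homogeneous (Suc 0) (?f k)"
    by (simp add: homogeneous_def poly_functions.linear linear_functional_pairing
        pairing_scale_right)
  moreover have "\<forall>y\<in>pure_spinors p. spinor_section p w y = (\<chi> k. ?f k y / 1)"
    by (simp add: spinor_section_def)
  ultimately show "\<exists>d g f. homogeneous d g \<and> (\<forall>k. homogeneous (Suc d) (f k)) \<and> g y \<noteq> 0 \<and>
      (\<forall>y\<in>pure_spinors p. g y \<noteq> 0 \<longrightarrow> spinor_section p w y = (\<chi> k. f k y / g y))"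
    by (intro exI [of _ 0] exI [of _ "\<lambda>_. 1"] exI [of _ ?f]) simp
next
  show "spinor_section p w y = 0" if "y \<notin> pure_spinors p" for y :: "'n spinor"
    using that by (simp add: spinor_section_def)
qed

text \<open>Self-adjointness of u and u.u.x = x recover the pairing with w from the section, which makes w
computable from its section and predicts the w that belongs to a given section.\<close>

lemma spinor_section_norm:
  assumes x: "x \<in> pure_spinors (\<not> p)" and u: "qform u = 1"
  shows "bform (spinor_section p w (cliff u x)) u = pairing w x"
proof -
  have uu: "cliff u (cliff u x) = x" by (simp add: clifford_relation u)
  then have "cliff u x \<noteq> 0" using x by (auto simp: pure_spinors_def)
  then have "cliff u x \<in> pure_spinors p" using cliff_pure [OF x] by simp
  then show ?thesis by (simp add: bform_spinor_section pairing_cliff uu)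
qed

lemma even_card_Compl:
  fixes J :: "'n::finite set"
  assumes "odd CARD('n)"
  shows "even (card (- J)) \<longleftrightarrow> odd (card J)"
proof -
  have "card J + card (- J) = CARD('n)"
    using card_Un_disjoint [of J "- J"] by simp
  then show ?thesis using assms by (metis even_add)
qed

text \<open>The space of global sections is the half-spin representation. By ruled_linear_norm_unit the norms
b(s(u.x), u) at a monomial x do not depend on the index of u = e_i + f_i, so matching them at one
index i0 matches them at all. The pairing with the monomial of J reads off the coordinate of w at the
complement of J; since n is odd the complement changes the parity, so this w has parity p.\<close>

lemma section_is_spinor_section:
  fixes s :: "'n::{finite,linorder} spinor \<Rightarrow> 'n quad"
  assumes odd: "odd CARD('n)" and s: "s \<in> sections p"
  obtains w where "w \<in> half_spin p" "s = spinor_section p w"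
proof -
  fix i0 :: 'n
  let ?u = "hyperbolic_unit i0"
  define w :: "'n spinor" where "w = (\<chi> K. if even (card K) \<longleftrightarrow> p
    then bform (s (cliff ?u (unit (- K)))) ?u / top_sign (- K) else 0)"
  have w: "w \<in> half_spin p" by (simp add: w_def half_spin_def)
  let ?h = "\<lambda>y. s y - spinor_section p w y"
  have h: "ruled_linear p ?h"
    using section_ruled_linear [OF s] section_ruled_linear [OF spinor_section_in_sections]
    by (rule ruled_linear_diff)
  have norm: "bform (?h (cliff (hyperbolic_unit i) (unit J))) (hyperbolic_unit i) = 0"
    if J: "even (card J) \<longleftrightarrow> \<not> p" for J i
  proof -
    have pure: "unit J \<in> pure_spinors (\<not> p)" using pure_unit [of J] J by simp
    have "pairing w (unit J) = bform (s (cliff ?u (unit J))) ?u"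
      using J even_card_Compl [OF odd, of J]
      by (simp add: pairing_unit w_def top_sign_nonzero)
    then have "bform (?h (cliff ?u (unit J))) ?u = 0"
      using spinor_section_norm [OF pure qform_hyperbolic_unit, of w i0]
      by (simp only: bform_diff_left diff_self)
    then show ?thesis
      using ruled_linear_norm_unit [OF h pure, of i i0] by (simp only:)
  qed
  have "?h y = 0" if "y \<in> pure_spinors p" for y
    by (rule ruled_linear_eq_0 [OF h ruled_linear_zero_on_units [OF h norm] that])
  moreover have "?h y = 0" if "y \<notin> pure_spinors p" for y
    using s that by (simp add: spinor_section_def sections_def)
  ultimately have "s = spinor_section p w" by (metis eq_iff_diff_eq_0 ext)
  then show thesis using that w by blast
qed

lemma spinor_section_injective:
  fixes w :: "'n::{finite,linorder} spinor"
  assumes odd: "odd CARD('n)" and w: "w \<in> half_spin p" and 0: "spinor_section p w = 0"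
  shows "w = 0"
proof -
  have "w $ K = 0" for K
  proof (cases "even (card K) \<longleftrightarrow> p")
    case True
    then have "unit (- K) \<in> pure_spinors (\<not> p)"
      using pure_unit [of "- K"] even_card_Compl [OF odd, of K] by simp
    from spinor_section_norm [OF this qform_hyperbolic_unit, of w]
    have "pairing w (unit (- K)) = 0" by (simp add: 0)
    then show ?thesis by (simp add: pairing_unit top_sign_nonzero)
  next
    case False
    then show ?thesis using w by (auto simp: half_spin_def)
  qed
  then show ?thesis by (simp add: vec_eq_iff)
qed

section \<open>Polynomial functions on sections, and the action of the spin group\<close>

lemma vector_space_scale_section: "vector_space scale_section"
  by unfold_locales
    (simp_all add: scale_section_def fun_eq_iff vec.scale_right_distrib vec.scale_left_distrib)

lemma linear_spinor_section: "Vector_Spaces.linear (*s) scale_section (spinor_section p)"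
  unfolding Vector_Spaces.linear_iff
  by (simp add: vec.vector_space_axioms vector_space_scale_section)
    (simp add: fun_eq_iff vec_eq_iff spinor_section_def scale_section_def cliff_add_right
      cliff_scale_right pairing_add_left pairing_scale_left)

lemma poly_functions_compose:
  assumes g: "Vector_Spaces.linear s1 s2 g" and "f \<in> poly_functions s2"
  shows "(\<lambda>x. f (g x)) \<in> poly_functions s1"
  using assms(2)
proof (induction rule: poly_functions.induct)
  case (linear f)
  then show ?case
    using poly_functions.linear [OF Vector_Spaces.linear_compose [OF g, of "(*)" f]]
    by (simp add: comp_def)
qed (auto intro: poly_functions.intros)

lemma zero_locus_spinor_section:
  fixes w :: "'n::{finite,linorder} spinor"
  shows "zero_locus p (spinor_section p w) =
    lines {y \<in> pure_spinors p. \<forall>v. pairing (cliff v w) y = 0}"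
proof -
  have "spinor_section p w y = 0 \<longleftrightarrow> (\<forall>v. pairing (cliff v w) y = 0)"
    if y: "y \<in> pure_spinors p" for y :: "'n spinor"
  proof
    show "\<forall>v. pairing (cliff v w) y = 0" if "spinor_section p w y = 0"
      using bform_spinor_section [OF y, of w] that by simp
    show "spinor_section p w y = 0" if "\<forall>v. pairing (cliff v w) y = 0"
      using y that by (simp add: spinor_section_def vec_eq_iff)
  qed
  then show ?thesis unfolding zero_locus_def by (intro arg_cong [of _ _ lines]) blast
qed

lemma spinor_variety_cap_orth_space:
  "spinor_variety p \<inter> lines (orth_space p z) =
    lines {y \<in> pure_spinors p. \<forall>v. pairing (cliff v z) y = 0}" (is "?L = lines ?A")
proof
  show "?L \<subseteq> lines ?A"
  proof
    fix l assume "l \<in> ?L"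
    then obtain y y' where y: "y \<in> pure_spinors p" "l = vec.span {y}"
        and y': "y' \<in> orth_space p z" "l = vec.span {y'}"
      by (auto simp: spinor_variety_def lines_def)
    have "y \<in> vec.span {y'}" using y y' by (metis singletonI vec.span_base)
    then obtain c where "y = c *s y'" by (auto simp: vec.span_singleton)
    then have "y \<in> ?A" using y y' by (simp add: orth_space_def pairing_scale_right)
    then show "l \<in> lines ?A" using y by (auto simp: lines_def pure_spinors_def)
  qed
  show "lines ?A \<subseteq> ?L"
    by (auto simp: lines_def spinor_variety_def orth_space_def pure_spinors_def)
qed

text \<open>For a of norm 1, conjugation by a carries v to a combination of a and v, so the condition of
orthogonality to V.w is carried along by the action of a on both spinors.\<close>

lemma cliff_perp:
  assumes "qform a = 1" and "\<forall>v. pairing (cliff v w) y = 0"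
  shows "pairing (cliff v (cliff a w)) (cliff a y) = 0"
proof -
  have "cliff a (cliff v (cliff a w)) = cliff (bform a v *s a - v) w"
    using assms(1)
    by (simp add: clifford_swap [of a v] clifford_relation cliff_diff_left cliff_scale_left)
  then show ?thesis using assms(2) by (simp add: pairing_cliff [symmetric])
qed

lemma foldr_cliff_perp:
  assumes "\<forall>v\<in>set vs. qform v = 1" and "\<forall>v. pairing (cliff v w) y = 0"
  shows "\<forall>v. pairing (cliff v (foldr cliff vs w)) (foldr cliff vs y) = 0"
  using assms(1) by (induction vs) (simp_all add: assms(2) cliff_perp)

lemma foldr_cliff_inverse:
  assumes "\<forall>v\<in>set vs. qform v = 1"
  shows "foldr cliff (rev vs) (foldr cliff vs y) = y"
  using assms by (induction vs) (simp_all add: clifford_relation)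

lemma foldr_cliff_half_spin:
  assumes "y \<in> half_spin p"
  shows "foldr cliff vs y \<in> half_spin (p \<longleftrightarrow> even (length vs))"
proof (induction vs)
  case (Cons v vs)
  then show ?case using cliff_half_spin [OF Cons, of v] by (simp add: iff_left_commute) 
qed (use assms in simp)

lemma foldr_cliff_pure:
  assumes "\<forall>v\<in>set vs. qform v = 1" and y: "y \<in> pure_spinors p"
  shows "foldr cliff vs y \<in> pure_spinors (p \<longleftrightarrow> even (length vs))"
  using assms(1)
proof (induction vs)
  case (Cons v vs)
  let ?x = "foldr cliff vs y"
  have x: "?x \<in> pure_spinors (p \<longleftrightarrow> even (length vs))" using Cons by simp
  have "cliff v (cliff v ?x) = ?x" using Cons.prems by (simp add: clifford_relation)
  then have "cliff v ?x \<noteq> 0" using x by (auto simp: pure_spinors_def)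
  then show ?case using cliff_pure [OF x, of v] by (simp add: iff_left_commute)
qed (use y in simp)

lemma linear_foldr_cliff: "Vector_Spaces.linear (*s) (*s) (foldr cliff vs)"
proof (rule linear_vecI)
  show "foldr cliff vs (x + y) = foldr cliff vs x + foldr cliff vs y" for x y
    by (induction vs) (simp_all add: cliff_add_right)
  show "foldr cliff vs (c *s x) = c *s foldr cliff vs x" for c x
    by (induction vs) (simp_all add: cliff_scale_right)
qed

lemma image_lines:
  fixes \<phi> :: "'a::finite spinor \<Rightarrow> 'a spinor"
  assumes "Vector_Spaces.linear (*s) (*s) \<phi>" and inj: "inj \<phi>"
  shows "(\<lambda>l. \<phi> ` l) ` lines A = lines (\<phi> ` A)"
proof -
  have span: "\<phi> ` vec.span {y} = vec.span {\<phi> y}" for y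
    using vec.linear_span_image [OF assms(1), of "{y}"] by simp
  have "\<phi> y = 0 \<longleftrightarrow> y = 0" for y
    using vec.linear_inj_iff_eq_0 [OF assms(1)] inj vec.linear_0 [OF assms(1)] by metis
  then have "\<phi> ` {y \<in> A. y \<noteq> 0} = {y \<in> \<phi> ` A. y \<noteq> 0}" by auto
  moreover have "lines B = (\<lambda>y. vec.span {y}) ` {y \<in> B. y \<noteq> 0}" for B :: "'a spinor set"
    by (auto simp: lines_def)
  ultimately show ?thesis
    by (simp add: image_image span flip: image_image [of "\<lambda>y. vec.span {y}" \<phi>])
qed

text \<open>The inverse of g, the product of the same vectors in reverse order, is linear, preserves the half-spin
representation and its pure spinors, and carries the orthogonal of V.(g z) to that of V.z.\<close>

lemma zero_locus_proj_isomorphic: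
  fixes z :: "'n::{finite,linorder} spinor"
  assumes g: "g \<in> spin_group" and c: "c \<noteq> 0"
  shows "proj_isomorphic (half_spin p) (zero_locus p (spinor_section p (c *s g z)))
    (spinor_variety p \<inter> lines (orth_space p z))"
proof -
  obtain vs where vs: "g = foldr cliff vs" "even (length vs)" "\<forall>v\<in>set vs. qform v = 1"
    using g by (auto simp: spin_group_def)
  define \<phi> where "\<phi> = foldr cliff (rev vs)"
  have rev: "\<forall>v\<in>set (rev vs). qform v = 1" using vs(3) by simp
  have inv: "\<phi> (g y) = y" "g (\<phi> y) = y" for y
    using foldr_cliff_inverse [OF vs(3)] foldr_cliff_inverse [OF rev]
    by (simp_all add: vs(1) \<phi>_def)
  have lin: "Vector_Spaces.linear (*s) (*s) \<phi>" by (simp add: \<phi>_def linear_foldr_cliff)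
  have inj: "inj \<phi>" using inv(2) by (metis injI)
  have half: "g y \<in> half_spin p" "\<phi> y \<in> half_spin p" if "y \<in> half_spin p" for y
    using foldr_cliff_half_spin [OF that, of vs] foldr_cliff_half_spin [OF that, of "rev vs"] vs
    by (simp_all add: \<phi>_def)
  have pure: "g y \<in> pure_spinors p" "\<phi> y \<in> pure_spinors p" if "y \<in> pure_spinors p" for y
    using foldr_cliff_pure [OF vs(3) that] foldr_cliff_pure [OF rev that] vs
    by (simp_all add: \<phi>_def)
  let ?A = "\<lambda>w. {y \<in> pure_spinors p. \<forall>v. pairing (cliff v w) y = 0}"
  have "\<phi> y \<in> ?A z" if "y \<in> ?A (c *s g z)" for y
    using that c pure foldr_cliff_perp [OF rev, of "g z" y]
    by (simp add: cliff_scale_right pairing_scale_left inv(1) flip: \<phi>_def)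
  moreover have "g y \<in> ?A (c *s g z)" if "y \<in> ?A z" for y
    using that pure foldr_cliff_perp [OF vs(3), of z y]
    by (simp add: cliff_scale_right pairing_scale_left flip: vs(1))
  ultimately have "\<phi> ` ?A (c *s g z) = ?A z"
  proof (intro equalityI subsetI)
    fix y assume "y \<in> ?A z"
    then have "g y \<in> ?A (c *s g z)" by fact
    then have "\<phi> (g y) \<in> \<phi> ` ?A (c *s g z)" by (rule imageI)
    then show "y \<in> \<phi> ` ?A (c *s g z)" by (simp only: inv(1))
  qed blast
  moreover have "bij_betw \<phi> (half_spin p) (half_spin p)"
    by (rule bij_betw_byWitness [of _ g]) (use inv half in auto)
  ultimately show ?thesis
    unfolding proj_isomorphic_def zero_locus_spinor_section spinor_variety_cap_orth_space
    by (intro exI [of _ \<phi>] conjI) (simp_all add: lin image_lines [OF lin inj])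
qed

text \<open>The parameter w is recovered from its section by a linear map g on all functions, a left inverse of
w \<mapsto> s_w. The equations of the complement of the orbit, composed with g, are then polynomials on
the space of sections.\<close>

theorem proposition2:
  fixes p :: bool and z :: "7 spinor"
  assumes "z \<in> half_spin p" and "z \<noteq> 0"
    and "zariski_open_proj (half_spin p) (spin_orbit z)"
  shows "\<exists>W \<subseteq> sections p. W \<noteq> {} \<and> zariski_open_in scale_section (sections p) W \<and>
    (\<forall>s\<in>W. proj_isomorphic (half_spin p) (zero_locus p s) (double_cayley p z))"
proof -
  obtain F where F: "\<And>f. f \<in> F \<Longrightarrow> \<exists>d. homogeneous d f"
      and orbit: "spin_orbit z = lines {y \<in> half_spin p. \<exists>f\<in>F. f y \<noteq> 0}"
    using assms(3) by (auto simp: zariski_open_proj_def)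
  have odd: "odd CARD(7)" by simp
  interpret scale: vector_space_pair "(*s) :: complex \<Rightarrow> 7 spinor \<Rightarrow> 7 spinor" scale_section
    by (simp add: vector_space_pair_def vec.vector_space_axioms vector_space_scale_section)
  have "inj_on (spinor_section p :: 7 spinor \<Rightarrow> _) (half_spin p)"
  proof (rule inj_onI)
    fix w w' :: "7 spinor"
    assume "w \<in> half_spin p" "w' \<in> half_spin p" "spinor_section p w = spinor_section p w'"
    then have "spinor_section p (w - w') = 0" "w - w' \<in> half_spin p"
      using scale.linear_diff [OF linear_spinor_section] vec.subspace_diff [OF subspace_half_spin]
      by auto
    then show "w = w'" using spinor_section_injective [OF odd] by force
  qed
  then obtain g :: "(7 spinor \<Rightarrow> 7 quad) \<Rightarrow> 7 spinor"
    where lin: "Vector_Spaces.linear scale_section (*s) g"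
      and g: "\<And>w. w \<in> half_spin p \<Longrightarrow> g (spinor_section p w) = w"
    using scale.linear_exists_left_inverse_on [OF linear_spinor_section subspace_half_spin] by metis
  have coord: "Vector_Spaces.linear (*s) (*) (\<lambda>w :: 7 spinor. w $ I)" for I :: "7 set"
    using linear_functional_pairing [of "0 :: 7 spinor"]
    by (simp add: Vector_Spaces.linear_iff)
  \<comment> \<open>A nonzero f of degree 0 is constant, so f alone does not exclude w = 0; the coordinate factor does.\<close>
  define F' where "F' = (\<Union>f\<in>F. range (\<lambda>I s. f (g s) * g s $ I))"
  have F': "F' \<subseteq> poly_functions scale_section"
  proof -
    have "(\<lambda>s. f (g s) * g s $ I) \<in> poly_functions scale_section" if "f \<in> F" for f I
    proof (rule poly_functions.mult)
      show "(\<lambda>s. f (g s)) \<in> poly_functions scale_section"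
        using F [OF that] poly_functions_compose [OF lin] by (auto simp: homogeneous_def)
      show "(\<lambda>s. g s $ I) \<in> poly_functions scale_section"
        by (rule poly_functions_compose [OF lin poly_functions.linear [OF coord]])
    qed
    then show ?thesis by (auto simp: F'_def)
  qed
  have F'_nonzero: "(\<exists>f\<in>F'. f (spinor_section p w) \<noteq> 0) \<longleftrightarrow> w \<noteq> 0 \<and> (\<exists>f\<in>F. f w \<noteq> 0)"
    if "w \<in> half_spin p" for w
  proof -
    have "w \<noteq> 0 \<longleftrightarrow> (\<exists>I. w $ I \<noteq> 0)" by (simp add: vec_eq_iff)
    then show ?thesis by (auto simp: F'_def g [OF that])
  qed
  let ?W = "{s \<in> sections p. \<exists>f\<in>F'. f s \<noteq> 0}"
  have "proj_isomorphic (half_spin p) (zero_locus p s) (double_cayley p z)" if s: "s \<in> ?W" for s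
  proof -
    have "s \<in> sections p" using s by simp
    then obtain w where w: "w \<in> half_spin p" "s = spinor_section p w"
      using section_is_spinor_section [OF odd] by metis
    then have "w \<noteq> 0" "\<exists>f\<in>F. f w \<noteq> 0" using s F'_nonzero by auto
    then have "vec.span {w} \<in> spin_orbit z" using w(1) by (auto simp: orbit lines_def)
    then obtain h where h: "h \<in> spin_group" "vec.span {w} = vec.span {h z}"
      by (auto simp: spin_orbit_def)
    then have "w \<in> vec.span {h z}" by (metis singletonI vec.span_base)
    then obtain c where "w = c *s h z" by (auto simp: vec.span_singleton)
    then show ?thesis
      using zero_locus_proj_isomorphic [OF h(1), of c p z] \<open>w \<noteq> 0\<close> w(2)
      by (auto simp: double_cayley_def)
  qed
  moreover have "?W \<noteq> {}"
  proof -
    have "foldr cliff [] \<in> spin_group"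
      unfolding spin_group_def by (intro CollectI exI [of _ "[]"]) simp
    then have "vec.span {z} \<in> spin_orbit z"
      unfolding spin_orbit_def by (intro CollectI exI [of _ "foldr cliff []"]) simp
    then obtain y where "y \<in> half_spin p" "y \<noteq> 0" "\<exists>f\<in>F. f y \<noteq> 0"
      by (auto simp: orbit lines_def)
    then have "spinor_section p y \<in> ?W"
      using F'_nonzero spinor_section_in_sections by simp
    then show ?thesis by blast
  qed
  moreover have "zariski_open_in scale_section (sections p) ?W"
    using F' by (auto simp: zariski_open_in_def)
  ultimately show ?thesis by (intro exI [of _ ?W]) auto
qed

end
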